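(* Let $p\in(0,2]$ and $n\ge2$. Then for any origin-symmetric star-shaped bodies $K,L\subset\mathbb R^n$ such that $$\int_{K\cap\xi^\perp}\|x\|_p\,dx\le\int_{L\cap\xi^\perp}\|x\|_p\,dx\qquad\text{for every }\xi\in S^{n-1},$$ we have $$\mathrm{Vol}_n(K)\le\mathrm{Vol}_n(L).$$
   Context: $\|x\|_p=\left(\sum_{i=1}^n|x_i|^p\right)^{1/p}$. $\xi^\perp$ is the hyperplane through the origin orthogonal to $\xi$, with $(n-1)$-dimensional Lebesgue measure. A star-shaped body is a compact set with non-empty interior that is star-shaped with respect to the origin. *)

theory Defs
  imports "HOL-Analysis.Analysis"
begin

definition lp_norm :: "real \<Rightarrow> real ^ 'n \<Rightarrow> real" where
  "lp_norm p x = (\<Sum>i\<in>UNIV. \<bar>x $ i\<bar> powr p) powr (1 / p)"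

definition orthonormal_basis_of :: "'a::euclidean_space set \<Rightarrow> 'a set \<Rightarrow> bool" where
  "orthonormal_basis_of S B \<longleftrightarrow>
     pairwise orthogonal B \<and> (\<forall>b\<in>B. norm b = 1) \<and> span B = S"

lemma orthonormal_basis_of_exists:
  assumes "subspace S"
  shows "\<exists>B. orthonormal_basis_of S B"
  using orthonormal_basis_subspace[OF assms] unfolding orthonormal_basis_of_def by metis

lemma orthonormal_basis_of_finite:
  assumes "orthonormal_basis_of S B"
  shows "finite B" and "card B = dim S"
proof -
  have "0 \<notin> B" using assms unfolding orthonormal_basis_of_def by force
  then have "independent B"
    using assms pairwise_orthogonal_independent unfolding orthonormal_basis_of_def by blast
  then show "finite B" and "card B = dim S"
    using assms independent_imp_finite[of B] dim_span_eq_card_independent[of B]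
    unfolding orthonormal_basis_of_def by auto
qed

text \<open>
  Lebesgue measure of dimension \<open>dim S\<close> on a linear subspace \<open>S\<close>, as a Borel measure on the
  ambient space concentrated on \<open>S\<close>. This is the construction of \<^const>\<open>lborel\<close> with the
  standard basis replaced by an orthonormal basis of \<open>S\<close>; since Lebesgue measure is invariant
  under orthogonal maps, the result does not depend on the basis that is chosen.
\<close>
definition subspace_lborel :: "'a::euclidean_space set \<Rightarrow> 'a measure" where
  "subspace_lborel S =
     (let B = (SOME B. orthonormal_basis_of S B)
      in distr (\<Pi>\<^sub>M b\<in>B. (lborel :: real measure)) borel (\<lambda>f. \<Sum>b\<in>B. f b *\<^sub>R b))"

definition star_body :: "'a::euclidean_space set \<Rightarrow> bool" where
  "star_body K \<longleftrightarrow> compact K \<and> interior K \<noteq> {} \<and> (\<forall>x\<in>K. closed_segment 0 x \<subseteq> K)"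

definition origin_symmetric :: "'a::euclidean_space set \<Rightarrow> bool" where
  "origin_symmetric K \<longleftrightarrow> uminus ` K = K"

end

theory Submission
  imports Defs "HOL-Probability.Sinc_Integral" "HOL-Real_Asymp.Real_Asymp"
begin

text \<open>
  For \<open>p \<le> 2\<close> the function \<open>exp (- t\<^sup>p)\<close> is a limit of mixtures of Gaussians \<open>exp (- s t\<^sup>2)\<close>,
  because all coefficients of the power series of \<open>1 - (1 - z)\<^sup>\<alpha>\<close> are nonnegative for \<open>\<alpha> = p/2 \<le> 1\<close>.
  Taking products over the coordinates and integrating over all dilations, \<open>1 / \<parallel>x\<parallel>\<^sub>p\<close> becomes a limit
  of mixtures of the functions \<open>(\<Sum>i. s\<^sub>i x\<^sub>i\<^sup>2)\<close> to the power \<open>-1/2\<close>. Integrating \<open>F\<close> against such a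
  function amounts to averaging the integrals of \<open>F\<close> over the hyperplanes \<open>u\<^sup>\<bottom>\<close> with positive weights,
  \<open>u\<close> being a Gaussian vector with variances proportional to \<open>s\<^sub>i\<close>. Applied to \<open>F = \<parallel>x\<parallel>\<^sub>p\<close> on \<open>K\<close>, the
  hypothesis on the sections thus gives an inequality between the integrals of
  \<open>\<parallel>x\<parallel>\<^sub>p / \<parallel>x\<parallel>\<^sub>p = 1\<close> over \<open>K\<close> and \<open>L\<close>.
\<close>

section \<open>Lebesgue measure on hyperplanes\<close>

lemma nn_integral_lborel_translate:
  fixes F :: "'a::euclidean_space \<Rightarrow> ennreal"
  assumes [measurable]: "F \<in> borel_measurable borel"
  shows "(\<integral>\<^sup>+x. F (x + a) \<partial>lborel) = (\<integral>\<^sup>+x. F x \<partial>lborel)"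
proof -
  have "(\<integral>\<^sup>+x. F x \<partial>lborel) = (\<integral>\<^sup>+x. F x \<partial>distr lborel borel ((+) a))"
    by (simp add: lborel_distr_plus)
  also have "\<dots> = (\<integral>\<^sup>+x. F (x + a) \<partial>lborel)"
    by (simp add: nn_integral_distr add.commute)
  finally show ?thesis ..
qed

lemma nn_integral_lborel_uminus:
  fixes F :: "'a::euclidean_space \<Rightarrow> ennreal"
  assumes [measurable]: "F \<in> borel_measurable borel"
  shows "(\<integral>\<^sup>+x. F (- x) \<partial>lborel) = (\<integral>\<^sup>+x. F x \<partial>lborel)"
proof -
  have "(\<integral>\<^sup>+x. F x \<partial>lborel) = (\<integral>\<^sup>+x. F x \<partial>density (distr lborel borel (\<lambda>x. 0 + (-1) *\<^sub>R x)) (\<lambda>_. \<bar>-1::real\<bar>^DIM('a)))"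
    using lborel_affine[of "-1" "0::'a"] by simp
  also have "\<dots> = (\<integral>\<^sup>+x. F (- x) \<partial>lborel)"
    by (subst nn_integral_density) (auto simp: nn_integral_distr)
  finally show ?thesis ..
qed

text \<open>This is the uniqueness argument for Haar measure. The double integral of f(x) g(y)
  against \<open>M\<close> and \<open>lborel\<close> is transformed by y -> y + x, then x -> x - y,
  then y -> -y, which exchanges the roles of the two measures. The test function \<open>g\<close>
  fixes the constant of proportionality to be 1.\<close>

lemma translation_invariant_eq_lborel:
  fixes M :: "'a::euclidean_space measure" and g :: "'a \<Rightarrow> ennreal"
  assumes sets_M [measurable_cong]: "sets M = sets borel"
    and "sigma_finite_measure M"
    and inv: "\<And>a. distr M borel (\<lambda>x. x + a) = M"
    and g[measurable]: "g \<in> borel_measurable borel"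
    and eq: "(\<integral>\<^sup>+x. g x \<partial>M) = (\<integral>\<^sup>+x. g x \<partial>lborel)"
    and pos: "(\<integral>\<^sup>+x. g x \<partial>lborel) \<noteq> 0" and fin: "(\<integral>\<^sup>+x. g x \<partial>lborel) \<noteq> \<infinity>"
  shows "M = lborel"
proof (rule measure_eqI)
  interpret M: sigma_finite_measure M by fact
  interpret P: pair_sigma_finite M lborel ..
  have tr: "(\<integral>\<^sup>+x. F (x + a) \<partial>M) = (\<integral>\<^sup>+x. F x \<partial>M)" if [measurable]: "F \<in> borel_measurable borel"
    for F :: "'a \<Rightarrow> ennreal" and a
  proof -
    have "(\<integral>\<^sup>+x. F x \<partial>M) = (\<integral>\<^sup>+x. F x \<partial>distr M borel (\<lambda>x. x + a))" by (simp add: inv)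
    also have "\<dots> = (\<integral>\<^sup>+x. F (x + a) \<partial>M)" by (subst nn_integral_distr) auto
    finally show ?thesis ..
  qed
  fix A assume "A \<in> sets M"
  then have [measurable]: "A \<in> sets borel" by (simp add: sets_M)
  let ?f = "indicator A :: 'a \<Rightarrow> ennreal"
  have "(\<integral>\<^sup>+x. ?f x \<partial>M) * (\<integral>\<^sup>+y. g y \<partial>lborel) = (\<integral>\<^sup>+x. (\<integral>\<^sup>+y. ?f x * g y \<partial>lborel) \<partial>M)"
    by (simp add: nn_integral_cmult nn_integral_multc)
  also have "\<dots> = (\<integral>\<^sup>+x. (\<integral>\<^sup>+y. ?f x * g (y + x) \<partial>lborel) \<partial>M)"
    by (rule nn_integral_cong) (simp add: nn_integral_cmult nn_integral_lborel_translate)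
  also have "\<dots> = (\<integral>\<^sup>+y. (\<integral>\<^sup>+x. ?f x * g (y + x) \<partial>M) \<partial>lborel)"
    by (rule P.Fubini'[symmetric]) simp
  also have "\<dots> = (\<integral>\<^sup>+y. (\<integral>\<^sup>+x. ?f (x + - y) * g x \<partial>M) \<partial>lborel)"
    by (rule nn_integral_cong) (use tr[symmetric, of "\<lambda>x. ?f x * g (y + x)" "- y" for y] in simp)
  also have "\<dots> = (\<integral>\<^sup>+x. (\<integral>\<^sup>+y. ?f (x + - y) * g x \<partial>lborel) \<partial>M)"
    by (rule P.Fubini') simp
  also have "\<dots> = (\<integral>\<^sup>+x. (\<integral>\<^sup>+y. ?f (y + x) * g x \<partial>lborel) \<partial>M)"
    by (rule nn_integral_cong) (subst nn_integral_lborel_uminus[symmetric], auto simp: add.commute)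
  also have "\<dots> = (\<integral>\<^sup>+y. ?f y \<partial>lborel) * (\<integral>\<^sup>+x. g x \<partial>M)"
    by (simp add: nn_integral_cmult nn_integral_multc nn_integral_lborel_translate)
  finally have "emeasure M A * (\<integral>\<^sup>+y. g y \<partial>lborel) = emeasure lborel A * (\<integral>\<^sup>+y. g y \<partial>lborel)"
    by (simp add: eq sets_M)
  then show "emeasure M A = emeasure lborel A"
    using pos fin by (simp add: mult.commute[of _ "integral\<^sup>N lborel g"] ennreal_mult_cancel_left)
qed (simp add: sets_M)

lemma nn_integral_gauss:
  fixes a :: real
  assumes "a > 0"
  shows "(\<integral>\<^sup>+x. ennreal (exp (- a * x\<^sup>2)) \<partial>lborel) = ennreal (sqrt (pi / a))"
proof -
  have "has_bochner_integral lborel (\<lambda>x::real. exp (- x\<^sup>2)) (2 *\<^sub>R (sqrt pi / 2))"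
    using has_bochner_integral_even_function[OF gaussian_moment_0] by simp
  then have 1: "(\<integral>\<^sup>+x. ennreal (exp (- x\<^sup>2)) \<partial>lborel) = ennreal (sqrt pi)"
    by (subst nn_integral_eq_integral) (auto simp: has_bochner_integral_iff)
  have "ennreal (sqrt pi) = ennreal (sqrt a) * (\<integral>\<^sup>+x. ennreal (exp (- a * x\<^sup>2)) \<partial>lborel)"
    unfolding 1[symmetric]
    by (subst nn_integral_real_affine[where c="sqrt a" and t=0]) (use assms in \<open>auto simp: power_mult_distrib\<close>)
  then have "ennreal (1 / sqrt a) * ennreal (sqrt pi) = ennreal (1 / sqrt a) * ennreal (sqrt a) * (\<integral>\<^sup>+x. ennreal (exp (- a * x\<^sup>2)) \<partial>lborel)"
    by (simp add: mult.assoc)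
  then show ?thesis
    using assms by (simp add: ennreal_mult[symmetric] real_sqrt_divide)
qed

text \<open>Translating by a shifts each coordinate by its inner product with a, so the image
  measure is translation invariant. The Gaussian exp (- |x|^2) factorises in every orthonormal basis
  and has the same integral for both measures, which settles the normalisation.\<close>

lemma orthonormal_basis_lborel:
  fixes C :: "'a::euclidean_space set"
  assumes C: "orthonormal_basis_of UNIV C"
  shows "distr (\<Pi>\<^sub>M b\<in>C. (lborel :: real measure)) borel (\<lambda>f. \<Sum>b\<in>C. f b *\<^sub>R b) = lborel"
    (is "?M = _")
proof -
  have [simp]: "finite C" and cardC: "card C = DIM('a)"
    using orthonormal_basis_of_finite[OF C] by simp_all
  have orth: "b \<bullet> c = (if b = c then 1 else 0)" if "b \<in> C" "c \<in> C" for b c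
    using C that by (auto simp: orthonormal_basis_of_def pairwise_def orthogonal_def dot_square_norm)
  interpret product_sigma_finite "\<lambda>_::'a. lborel :: real measure" ..
  have meas[measurable]: "(\<lambda>f. \<Sum>b\<in>C. f b *\<^sub>R b) \<in> PiM C (\<lambda>_. lborel :: real measure) \<rightarrow>\<^sub>M borel"
    by measurable
  have coord: "(\<Sum>b\<in>C. f b *\<^sub>R b) \<bullet> c = f c" if "c \<in> C" for f c
    using that by (simp add: inner_sum_left orth if_distrib cong: if_cong)
  have expand: "(\<Sum>b\<in>C. (a \<bullet> b) *\<^sub>R b) = a" for a
  proof -
    have "a \<in> span C" using C by (simp add: orthonormal_basis_of_def)
    then obtain u where a: "a = (\<Sum>b\<in>C. u b *\<^sub>R b)"
      by (auto simp: span_finite)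
    then show ?thesis by (simp add: coord cong: sum.cong)
  qed
  let ?g = "\<lambda>x::'a. ennreal (exp (- (norm x)\<^sup>2))"
  have prod1: "?g (\<Sum>b\<in>C. f b *\<^sub>R b) = (\<Prod>b\<in>C. ennreal (exp (- (f b)\<^sup>2)))" for f
  proof -
    have "(norm (\<Sum>b\<in>C. f b *\<^sub>R b))\<^sup>2 = (\<Sum>b\<in>C. (f b)\<^sup>2)"
      unfolding power2_norm_eq_inner by (subst inner_sum_right) (simp add: coord power2_eq_square)
    then show ?thesis by (simp add: prod_ennreal exp_sum[symmetric] sum_negf)
  qed
  have prod2: "?g x = (\<Prod>b\<in>Basis. ennreal (exp (- (x \<bullet> b)\<^sup>2)))" for x
    by (simp add: prod_ennreal exp_sum[symmetric] sum_negf) (simp only: power2_norm_eq_inner power2_eq_square[of "norm x", symmetric] euclidean_inner[of x x], simp only: power2_eq_square)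
  have g1: "(\<integral>\<^sup>+x. ennreal (exp (- x\<^sup>2)) \<partial>lborel) = ennreal (sqrt pi)"
    using nn_integral_gauss[of 1] by simp
  have gC: "(\<integral>\<^sup>+x. ?g x \<partial>?M) = ennreal (sqrt pi) ^ DIM('a)"
    using product_nn_integral_prod[of C "\<lambda>_ t. ennreal (exp (- t\<^sup>2))"]
    by (simp add: nn_integral_distr prod1 cardC g1)
  have gL: "(\<integral>\<^sup>+x. ?g x \<partial>lborel) = ennreal (sqrt pi) ^ DIM('a)"
    unfolding prod2 using nn_integral_lborel_prod[of "\<lambda>_ t. ennreal (exp (- t\<^sup>2))"] by (simp add: g1)
  show ?thesis
  proof (rule translation_invariant_eq_lborel[where g = ?g])
    show "(\<integral>\<^sup>+x. ?g x \<partial>?M) = (\<integral>\<^sup>+x. ?g x \<partial>lborel)" by (simp only: gC gL)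
    show "(\<integral>\<^sup>+x. ?g x \<partial>lborel) \<noteq> 0" "(\<integral>\<^sup>+x. ?g x \<partial>lborel) \<noteq> \<infinity>"
      by (simp_all add: gL ennreal_power)
    show "sigma_finite_measure ?M"
    proof
      \<comment> \<open>On the ball of radius n the indicator is at most exp (n^2) times the
        Gaussian, whose integral is known.\<close>
      have "emeasure ?M (ball 0 (real n)) \<noteq> \<infinity>" for n
      proof -
        have "emeasure ?M (ball 0 (real n)) = (\<integral>\<^sup>+x. indicator (ball 0 (real n)) x \<partial>?M)" by simp
        also have "\<dots> \<le> (\<integral>\<^sup>+x. ennreal (exp ((real n)\<^sup>2)) * ?g x \<partial>?M)"
          by (intro nn_integral_mono)
            (auto simp: indicator_def ennreal_mult[symmetric] exp_add[symmetric] ennreal_1[symmetric]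
              simp del: ennreal_1 intro!: ennreal_leI power_mono)
        also have "\<dots> = ennreal (exp ((real n)\<^sup>2)) * ennreal (sqrt pi) ^ DIM('a)"
          by (subst nn_integral_cmult) (simp_all only: gC, simp)
        also have "\<dots> < \<infinity>" by (simp add: ennreal_power ennreal_mult_less_top)
        finally show ?thesis by simp
      qed
      moreover have "(\<Union>n. ball 0 (real n)) = (UNIV :: 'a set)"
        by (auto simp: reals_Archimedean2)
      ultimately show "\<exists>A. countable A \<and> A \<subseteq> sets ?M \<and> \<Union> A = space ?M \<and> (\<forall>a\<in>A. emeasure ?M a \<noteq> \<infinity>)"
        by (intro exI[of _ "range (\<lambda>n. ball 0 (real n))"]) auto
    qed
    fix a :: 'a
    have shift: "distr (PiM C (\<lambda>_. lborel)) (PiM C (\<lambda>_. lborel)) (\<lambda>f. \<lambda>b\<in>C. f b + a \<bullet> b)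
        = PiM C (\<lambda>_. lborel :: real measure)"
    proof (rule PiM_eqI)
      fix A assume A: "\<And>b. b \<in> C \<Longrightarrow> A b \<in> sets (lborel :: real measure)"
      have "emeasure (distr (PiM C (\<lambda>_. lborel)) (PiM C (\<lambda>_. lborel)) (\<lambda>f. \<lambda>b\<in>C. f b + a \<bullet> b)) (Pi\<^sub>E C A)
        = emeasure (PiM C (\<lambda>_. lborel)) (Pi\<^sub>E C (\<lambda>b. (\<lambda>t. t + a \<bullet> b) -` A b))"
        using A by (subst emeasure_distr) (auto intro!: arg_cong2[where f=emeasure] sets_PiM_I_finite simp: space_PiM PiE_iff extensional_def)
      also have "\<dots> = (\<Prod>b\<in>C. emeasure lborel ((\<lambda>t. t + a \<bullet> b) -` A b))"
        using A measurable_sets[of "\<lambda>t. t + a \<bullet> b" borel borel "A b" for b]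
        by (intro emeasure_PiM) auto
      also have "\<dots> = (\<Prod>b\<in>C. emeasure lborel (A b))"
      proof (intro prod.cong refl)
        fix b assume "b \<in> C"
        then have "A b \<in> sets borel" using A by simp
        moreover have "(\<lambda>t. t + a \<bullet> b) = (+) (a \<bullet> b)" by auto
        ultimately show "emeasure lborel ((\<lambda>t. t + a \<bullet> b) -` A b) = emeasure lborel (A b)"
          using lborel_distr_plus[of "a \<bullet> b"]
            emeasure_distr[of "(+) (a \<bullet> b)" lborel borel "A b"] by simp
      qed
      finally show "emeasure (distr (PiM C (\<lambda>_. lborel)) (PiM C (\<lambda>_. lborel)) (\<lambda>f. \<lambda>b\<in>C. f b + a \<bullet> b)) (Pi\<^sub>E C A)
        = (\<Prod>b\<in>C. emeasure lborel (A b))" .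
    qed simp_all
    have "distr ?M borel (\<lambda>x. x + a) = distr (PiM C (\<lambda>_. lborel)) borel (\<lambda>f. (\<Sum>b\<in>C. f b *\<^sub>R b) + a)"
      by (subst distr_distr) (auto simp: comp_def)
    also have "\<dots> = distr (PiM C (\<lambda>_. lborel)) borel (\<lambda>f. \<Sum>b\<in>C. (\<lambda>b\<in>C. f b + a \<bullet> b) b *\<^sub>R b)"
      by (subst (1) expand[of a, symmetric]) (simp add: scaleR_add_left sum.distrib)
    also have "\<dots> = distr (distr (PiM C (\<lambda>_. lborel)) (PiM C (\<lambda>_. lborel)) (\<lambda>f. \<lambda>b\<in>C. f b + a \<bullet> b)) borel (\<lambda>f. \<Sum>b\<in>C. f b *\<^sub>R b)"
      by (subst distr_distr) (auto simp: comp_def)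
    also have "\<dots> = ?M" by (simp add: shift)
    finally show "distr ?M borel (\<lambda>x. x + a) = ?M" .
  qed simp_all
qed

text \<open>Adding \<xi> to an orthonormal basis of the hyperplane gives one of the whole space, and
  the coordinate along \<xi> integrates to 1 over the unit interval. Section integrals thus become
  integrals over a slab of thickness 1, free of the basis chosen in
  \<open>subspace_lborel\<close>.\<close>

lemma nn_integral_hyperplane:
  fixes \<xi> :: "'a::euclidean_space"
  assumes \<xi>: "norm \<xi> = 1" and [measurable]: "F \<in> borel_measurable borel"
  shows "(\<integral>\<^sup>+x. F x \<partial>subspace_lborel {x. \<xi> \<bullet> x = 0})
    = (\<integral>\<^sup>+x. indicator {0..1} (\<xi> \<bullet> x) * F (x - (\<xi> \<bullet> x) *\<^sub>R \<xi>) \<partial>lborel)"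
proof -
  let ?H = "{x. \<xi> \<bullet> x = 0}"
  define B where "B = (SOME B. orthonormal_basis_of ?H B)"
  have B: "orthonormal_basis_of ?H B"
    unfolding B_def by (rule someI_ex) (rule orthonormal_basis_of_exists[OF subspace_hyperplane])
  have [simp]: "finite B" using orthonormal_basis_of_finite[OF B] by simp
  have BH: "\<xi> \<bullet> b = 0" if "b \<in> B" for b
    using B that span_base[of b B] by (auto simp: orthonormal_basis_of_def)
  have [simp]: "\<xi> \<bullet> \<xi> = 1" using \<xi> by (simp add: dot_square_norm)
  have [simp]: "\<xi> \<notin> B" using BH[of \<xi>] by auto
  have "orthonormal_basis_of UNIV (insert \<xi> B)"
    unfolding orthonormal_basis_of_def
  proof (intro conjI)
    show "pairwise orthogonal (insert \<xi> B)"
      using B BH by (auto simp: orthonormal_basis_of_def pairwise_insert orthogonal_def inner_commute)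
    show "\<forall>b\<in>insert \<xi> B. norm b = 1" using B \<xi> by (simp add: orthonormal_basis_of_def)
    have "x \<in> span (insert \<xi> B)" for x
    proof -
      have "x - (\<xi> \<bullet> x) *\<^sub>R \<xi> \<in> span B"
        using B by (simp add: orthonormal_basis_of_def inner_diff_right)
      then show ?thesis unfolding span_insert by blast
    qed
    then show "span (insert \<xi> B) = UNIV" by blast
  qed
  note L = orthonormal_basis_lborel[OF this]
  interpret product_sigma_finite "\<lambda>_::'a. lborel :: real measure" ..
  have [simp]: "(\<Sum>b\<in>B. (if b = \<xi> then y else f b) *\<^sub>R b) = (\<Sum>b\<in>B. f b *\<^sub>R b)" for f and y :: real
    by (intro sum.cong) auto
  have *: "\<xi> \<bullet> (\<Sum>b\<in>B. f b *\<^sub>R b) = 0" for f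
    by (simp add: inner_sum_right BH)
  have "(\<integral>\<^sup>+x. indicator {0..1} (\<xi> \<bullet> x) * F (x - (\<xi> \<bullet> x) *\<^sub>R \<xi>) \<partial>lborel)
    = (\<integral>\<^sup>+f. indicator {0..1} (\<xi> \<bullet> (\<Sum>b\<in>insert \<xi> B. f b *\<^sub>R b))
        * F ((\<Sum>b\<in>insert \<xi> B. f b *\<^sub>R b) - (\<xi> \<bullet> (\<Sum>b\<in>insert \<xi> B. f b *\<^sub>R b)) *\<^sub>R \<xi>) \<partial>PiM (insert \<xi> B) (\<lambda>_. lborel))"
    unfolding L[symmetric] by (subst nn_integral_distr) simp_all
  also have "\<dots> = (\<integral>\<^sup>+f. (\<integral>\<^sup>+y. indicator {0..1::real} y * F (\<Sum>b\<in>B. f b *\<^sub>R b) \<partial>lborel) \<partial>PiM B (\<lambda>_. lborel))"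
    by (subst product_nn_integral_insert) (simp_all add: inner_add_right *)
  also have "\<dots> = (\<integral>\<^sup>+f. F (\<Sum>b\<in>B. f b *\<^sub>R b) \<partial>PiM B (\<lambda>_. lborel))"
    by (simp add: nn_integral_multc)
  also have "\<dots> = (\<integral>\<^sup>+x. F x \<partial>subspace_lborel ?H)"
    unfolding subspace_lborel_def Let_def B_def[symmetric] by (simp add: nn_integral_distr)
  finally show ?thesis ..
qed

lemma nn_integral_indicator_affine:
  fixes a b :: real
  assumes "b \<noteq> 0"
  shows "ennreal \<bar>b\<bar> * (\<integral>\<^sup>+t. indicator {0..1} (a + t * b) \<partial>lborel) = 1"
proof -
  have "(\<integral>\<^sup>+t. indicator {0..1::real} t \<partial>lborel) = ennreal \<bar>b\<bar> * (\<integral>\<^sup>+t. indicator {0..1} (a + b * t) \<partial>lborel)"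
    using assms by (intro nn_integral_real_affine) auto
  then show ?thesis by (simp add: mult.commute)
qed

text \<open>Space is decomposed into lines parallel to \<open>e\<close>. Each line meets the slab
  where c . x lies in [0, 1] in a segment of parameter length 1 / |c . e|, which the factor in front
  compensates.\<close>

lemma nn_integral_slab:
  fixes c e :: "'a::euclidean_space"
  assumes ce: "c \<bullet> e \<noteq> 0" and [measurable]: "h \<in> borel_measurable borel"
  shows "(\<integral>\<^sup>+x. h x \<partial>lborel)
    = ennreal \<bar>c \<bullet> e\<bar> * (\<integral>\<^sup>+x. (\<integral>\<^sup>+t. indicator {0..1} (c \<bullet> x) * h (x + t *\<^sub>R e) \<partial>lborel) \<partial>lborel)"
proof -
  have "(\<integral>\<^sup>+x. (\<integral>\<^sup>+t. indicator {0..1} (c \<bullet> x) * h (x + t *\<^sub>R e) \<partial>lborel) \<partial>lborel)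
    = (\<integral>\<^sup>+t. (\<integral>\<^sup>+x. indicator {0..1} (c \<bullet> x) * h (x + t *\<^sub>R e) \<partial>lborel) \<partial>lborel)"
    by (rule lborel_pair.Fubini') measurable
  also have "\<dots> = (\<integral>\<^sup>+t. (\<integral>\<^sup>+x. indicator {0..1} (c \<bullet> x + t * (- (c \<bullet> e))) * h x \<partial>lborel) \<partial>lborel)"
  proof (rule nn_integral_cong)
    fix t :: real
    show "(\<integral>\<^sup>+x. indicator {0..1} (c \<bullet> x) * h (x + t *\<^sub>R e) \<partial>lborel)
      = (\<integral>\<^sup>+x. indicator {0..1} (c \<bullet> x + t * (- (c \<bullet> e))) * h x \<partial>lborel)"
      using nn_integral_lborel_translate[of "\<lambda>x. indicator {0..1} (c \<bullet> x + t * (- (c \<bullet> e))) * h x" "t *\<^sub>R e"]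
      by (simp add: inner_add_right)
  qed
  also have "\<dots> = (\<integral>\<^sup>+x. (\<integral>\<^sup>+t. indicator {0..1} (c \<bullet> x + t * (- (c \<bullet> e))) * h x \<partial>lborel) \<partial>lborel)"
    by (rule lborel_pair.Fubini') measurable
  also have "\<dots> = (\<integral>\<^sup>+x. (\<integral>\<^sup>+t. indicator {0..1} (c \<bullet> x + t * (- (c \<bullet> e))) \<partial>lborel) * h x \<partial>lborel)"
    by (rule nn_integral_cong) (rule nn_integral_multc, measurable)
  finally have "ennreal \<bar>c \<bullet> e\<bar> * (\<integral>\<^sup>+x. (\<integral>\<^sup>+t. indicator {0..1} (c \<bullet> x) * h (x + t *\<^sub>R e) \<partial>lborel) \<partial>lborel)
    = (\<integral>\<^sup>+x. (ennreal \<bar>- (c \<bullet> e)\<bar> * (\<integral>\<^sup>+t. indicator {0..1} (c \<bullet> x + t * (- (c \<bullet> e))) \<partial>lborel)) * h x \<partial>lborel)"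
    by (simp add: nn_integral_cmult mult.assoc)
  also have "\<dots> = (\<integral>\<^sup>+x. h x \<partial>lborel)"
    by (subst nn_integral_indicator_affine) (use ce in auto)
  finally show ?thesis ..
qed

text \<open>The orthogonal projection is replaced by the projection along \<open>e\<close>, and the
  slab by one cut out by \<open>c\<close>. With \<open>c\<close> and \<open>e\<close> fixed, the
  slab is the same for all \<xi>, so that an integration over \<xi> can later be exchanged with the
  one over x.\<close>

lemma nn_integral_hyperplane_oblique:
  fixes \<xi> c e :: "'a::euclidean_space"
  assumes \<xi>: "norm \<xi> = 1" and e: "\<xi> \<bullet> e \<noteq> 0" and ce: "c \<bullet> e = 1"
    and F[measurable]: "F \<in> borel_measurable borel"
  shows "(\<integral>\<^sup>+x. indicator {0..1} (c \<bullet> x) * F (x - (\<xi> \<bullet> x / (\<xi> \<bullet> e)) *\<^sub>R e) \<partial>lborel)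
    = ennreal \<bar>\<xi> \<bullet> e\<bar> * (\<integral>\<^sup>+x. F x \<partial>subspace_lborel {x. \<xi> \<bullet> x = 0})"
proof -
  define P where "P x = x - (\<xi> \<bullet> x / (\<xi> \<bullet> e)) *\<^sub>R e" for x
  have [measurable]: "P \<in> borel_measurable borel" unfolding P_def by measurable
  have [simp]: "\<xi> \<bullet> \<xi> = 1" using \<xi> by (simp add: dot_square_norm)
  have \<xi>P[simp]: "\<xi> \<bullet> P x = 0" for x using e by (simp add: P_def inner_diff_right)
  have Padd: "P (x + t *\<^sub>R y) = P x + t *\<^sub>R P y" for x t y
    by (simp add: P_def algebra_simps add_divide_distrib)
  have Pe: "P e = 0" using e by (simp add: P_def)
  have PP: "P x - (\<xi> \<bullet> x) *\<^sub>R P \<xi> = x - (\<xi> \<bullet> x) *\<^sub>R \<xi>" for x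
    by (simp add: P_def algebra_simps)
  let ?I = "\<integral>\<^sup>+x. F x \<partial>subspace_lborel {x. \<xi> \<bullet> x = 0}"
  let ?h = "\<lambda>x. indicator {0..1} (\<xi> \<bullet> x) * F (P x)"
  \<comment> \<open>Translation by a multiple of \<open>P \<xi>\<close>, which is orthogonal to
    \<xi>, preserves both \<xi> . x and Lebesgue measure. This absorbs the shear between the two
    projections.\<close>
  have sub: "(\<integral>\<^sup>+x. indicator {0..1} (\<xi> \<bullet> x) * F (x - (\<xi> \<bullet> x) *\<^sub>R \<xi> + t *\<^sub>R P \<xi>) \<partial>lborel) = ?I" for t
    using nn_integral_lborel_translate[of "\<lambda>x. indicator {0..1} (\<xi> \<bullet> x) * F (x - (\<xi> \<bullet> x) *\<^sub>R \<xi>)" "t *\<^sub>R P \<xi>"]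
    by (simp add: nn_integral_hyperplane[OF \<xi> F] inner_add_right algebra_simps)
  have "(\<integral>\<^sup>+x. ?h x \<partial>lborel)
      = (\<integral>\<^sup>+x. (\<integral>\<^sup>+t. indicator {0..1} (\<xi> \<bullet> x) * ?h (x + t *\<^sub>R \<xi>) \<partial>lborel) \<partial>lborel)"
    by (subst nn_integral_slab[of \<xi> \<xi>]) simp_all
  also have "\<dots> = (\<integral>\<^sup>+x. (\<integral>\<^sup>+t. indicator {0..1} (\<xi> \<bullet> x) * ?h ((x - (\<xi> \<bullet> x) *\<^sub>R \<xi>) + t *\<^sub>R \<xi>) \<partial>lborel) \<partial>lborel)"
  proof (rule nn_integral_cong)
    fix x
    have [measurable]: "(\<lambda>t::real. indicator {0..1} (\<xi> \<bullet> x) * ?h (x + t *\<^sub>R \<xi>)) \<in> borel_measurable borel"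
      by measurable
    show "(\<integral>\<^sup>+t. indicator {0..1} (\<xi> \<bullet> x) * ?h (x + t *\<^sub>R \<xi>) \<partial>lborel)
      = (\<integral>\<^sup>+t. indicator {0..1} (\<xi> \<bullet> x) * ?h ((x - (\<xi> \<bullet> x) *\<^sub>R \<xi>) + t *\<^sub>R \<xi>) \<partial>lborel)"
      using nn_integral_lborel_translate[of "\<lambda>t::real. indicator {0..1} (\<xi> \<bullet> x) * ?h (x + t *\<^sub>R \<xi>)" "- (\<xi> \<bullet> x)"]
      by (simp add: algebra_simps)
  qed
  also have "\<dots> = (\<integral>\<^sup>+x. (\<integral>\<^sup>+t. indicator {0..1} t * (indicator {0..1} (\<xi> \<bullet> x) * F (x - (\<xi> \<bullet> x) *\<^sub>R \<xi> + t *\<^sub>R P \<xi>)) \<partial>lborel) \<partial>lborel)"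
  proof -
    have "P ((x - (\<xi> \<bullet> x) *\<^sub>R \<xi>) + t *\<^sub>R \<xi>) = x - (\<xi> \<bullet> x) *\<^sub>R \<xi> + t *\<^sub>R P \<xi>" for x t
      using Padd[of x "- (\<xi> \<bullet> x)" \<xi>] by (simp add: Padd PP)
    then show ?thesis by (simp add: inner_add_right inner_diff_right mult_ac)
  qed
  also have "\<dots> = (\<integral>\<^sup>+t. (\<integral>\<^sup>+x. indicator {0..1} t * (indicator {0..1} (\<xi> \<bullet> x) * F (x - (\<xi> \<bullet> x) *\<^sub>R \<xi> + t *\<^sub>R P \<xi>)) \<partial>lborel) \<partial>lborel)"
    by (rule lborel_pair.Fubini') measurable
  also have "\<dots> = (\<integral>\<^sup>+t. indicator {0..1::real} t * ?I \<partial>lborel)"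
    by (rule nn_integral_cong) (subst nn_integral_cmult, auto simp: sub)
  also have "\<dots> = ?I" by (simp add: nn_integral_multc)
  finally have I: "?I = (\<integral>\<^sup>+x. ?h x \<partial>lborel)" ..
  \<comment> \<open>Now the lines run along \<open>e\<close>, which \<open>P\<close> annihilates: on
    each line only the indicator of the slab for \<xi> still depends on t.\<close>
  also have "\<dots> = (\<integral>\<^sup>+x. (\<integral>\<^sup>+t. indicator {0..1} (c \<bullet> x) * ?h (x + t *\<^sub>R e) \<partial>lborel) \<partial>lborel)"
    by (subst nn_integral_slab[of c e]) (simp_all add: ce)
  also have "\<dots> = (\<integral>\<^sup>+x. (\<integral>\<^sup>+t. indicator {0..1} (\<xi> \<bullet> x + t * (\<xi> \<bullet> e)) * (indicator {0..1} (c \<bullet> x) * F (P x)) \<partial>lborel) \<partial>lborel)"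
    by (simp add: Padd Pe inner_add_right mult_ac)
  also have "\<dots> = (\<integral>\<^sup>+x. (\<integral>\<^sup>+t. indicator {0..1} (\<xi> \<bullet> x + t * (\<xi> \<bullet> e)) \<partial>lborel) * (indicator {0..1} (c \<bullet> x) * F (P x)) \<partial>lborel)"
    by (rule nn_integral_cong) (rule nn_integral_multc, measurable)
  finally have "ennreal \<bar>\<xi> \<bullet> e\<bar> * ?I = (\<integral>\<^sup>+x. (ennreal \<bar>\<xi> \<bullet> e\<bar> * (\<integral>\<^sup>+t. indicator {0..1} (\<xi> \<bullet> x + t * (\<xi> \<bullet> e)) \<partial>lborel)) * (indicator {0..1} (c \<bullet> x) * F (P x)) \<partial>lborel)"
    by (simp add: nn_integral_cmult mult.assoc)
  also have "\<dots> = (\<integral>\<^sup>+x. indicator {0..1} (c \<bullet> x) * F (P x) \<partial>lborel)"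
    by (subst nn_integral_indicator_affine) (use e in auto)
  finally show ?thesis by (simp add: P_def)
qed

section \<open>Gaussian integrals in coordinates\<close>

lemma borel_measurable_vec_nth [measurable (raw)]:
  fixes f :: "'a \<Rightarrow> real ^ 'n"
  assumes "f \<in> borel_measurable M"
  shows "(\<lambda>x. f x $ k) \<in> borel_measurable M"
  using assms by (rule measurable_compose) (intro borel_measurable_continuous_onI continuous_intros)

lemma nn_integral_gauss_vec:
  fixes a :: "'n::finite \<Rightarrow> real"
  assumes a: "\<And>i. a i > 0"
  shows "(\<integral>\<^sup>+u. ennreal (exp (- (\<Sum>i\<in>UNIV. a i * (u $ i)\<^sup>2))) \<partial>(lborel :: (real ^ 'n) measure))
    = ennreal (\<Prod>i\<in>UNIV. sqrt (pi / a i))"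
proof -
  let ?ax = "\<lambda>i::'n. axis i (1::real)"
  have inj: "inj_on ?ax UNIV" by (auto simp: inj_on_def axis_eq_axis)
  have basis: "(Basis :: (real ^ 'n) set) = ?ax ` UNIV" by (auto simp: Basis_vec_def)
  \<comment> \<open>\<open>nn_integral_lborel_prod\<close> indexes the factors by basis vectors, so
    the exponents are transported through the inverse of \<open>axis\<close>.\<close>
  define f where "f b t = ennreal (exp (- a (inv ?ax b) * t\<^sup>2))" for b t
  have f: "f (?ax i) t = ennreal (exp (- a i * t\<^sup>2))" for i t
    using inv_f_f[OF inj, of i] by (simp add: f_def)
  then have f_int: "(\<integral>\<^sup>+t. f (?ax i) t \<partial>lborel) = ennreal (sqrt (pi / a i))" for i
    using nn_integral_gauss[OF a] by (simp only:)
  have "ennreal (exp (- (\<Sum>i\<in>UNIV. a i * (u $ i)\<^sup>2))) = (\<Prod>b\<in>Basis. f b (u \<bullet> b))" for u :: "real ^ 'n"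
    unfolding basis prod.reindex[OF inj]
    by (simp add: f o_def prod_ennreal exp_sum[symmetric] sum_negf inner_axis)
  then have "(\<integral>\<^sup>+u. ennreal (exp (- (\<Sum>i\<in>UNIV. a i * (u $ i)\<^sup>2))) \<partial>(lborel :: (real ^ 'n) measure))
    = (\<Prod>b\<in>(Basis :: (real ^ 'n) set). (\<integral>\<^sup>+t. f b t \<partial>lborel))"
    by (simp only:) (rule nn_integral_lborel_prod, auto simp: f_def)
  also have "\<dots> = (\<Prod>i\<in>UNIV. ennreal (sqrt (pi / a i)))"
    unfolding basis prod.reindex[OF inj] by (simp add: o_def f_int)
  also have "\<dots> = ennreal (\<Prod>i\<in>UNIV. sqrt (pi / a i))"
    by (rule prod_ennreal) (use a in \<open>simp add: less_imp_le\<close>)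
  finally show ?thesis .
qed

lemma AE_lborel_component_nonzero:
  "AE x in (lborel :: (real ^ 'n) measure). x $ k \<noteq> 0"
proof -
  have "negligible {x :: real ^ 'n. axis k 1 \<bullet> x = 0}"
    by (rule negligible_hyperplane) (simp add: axis_eq_0_iff)
  moreover have "closed {x :: real ^ 'n. axis k 1 \<bullet> x = 0}" by (rule closed_hyperplane)
  ultimately have "{x :: real ^ 'n. axis k 1 \<bullet> x = 0} \<in> null_sets lborel"
    by (auto simp: negligible_iff_null_sets null_sets_def borel_closed)
  then show ?thesis
    by (rule AE_I'[where N="{x. axis k 1 \<bullet> x = 0}"]) (auto simp: inner_axis')
qed

section \<open>Averages over hyperplanes with Gaussian weights\<close>

text \<open>
  Up to normalisation this is the law of \<open>- (u \<bullet> z) / u\<^sub>k\<close>. The Gaussian is split along the vector \<open>e\<close> with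
  entries \<open>s\<^sub>i z\<^sub>i\<close>, which is orthogonal to the kernel of \<open>z\<close> for the quadratic form \<open>Q\<close> and, as
  \<open>z\<^sub>k = 0\<close>, leaves \<open>u\<^sub>k\<close> unchanged.
\<close>

lemma gauss_ratio_distribution:
  fixes s :: "'n::finite \<Rightarrow> real" and z :: "real ^ 'n" and \<phi> :: "real \<Rightarrow> ennreal"
  assumes s: "\<And>i. s i > 0" and zk: "z $ k = 0" and z: "z \<noteq> 0"
    and \<phi>[measurable]: "\<phi> \<in> borel_measurable borel"
  shows "(\<integral>\<^sup>+u. ennreal (exp (- (\<Sum>i\<in>UNIV. (u $ i)\<^sup>2 / s i)) / \<bar>u $ k\<bar>) * \<phi> (- (u \<bullet> z) / u $ k) \<partial>lborel)
    = (\<integral>\<^sup>+t. \<phi> t * (ennreal ((\<Prod>i\<in>UNIV. sqrt (pi * s i)) / pi)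
        * (\<integral>\<^sup>+r. ennreal (exp (- ((\<Sum>i\<in>UNIV. s i * (z $ i)\<^sup>2) + s k * t\<^sup>2) * r\<^sup>2)) \<partial>lborel)) \<partial>lborel)"
proof -
  define S where "S = (\<Sum>i\<in>UNIV. s i * (z $ i)\<^sup>2)"
  define D where "D = (\<Prod>i\<in>UNIV. sqrt (pi * s i))"
  define Q where "Q u = (\<Sum>i\<in>UNIV. (u $ i)\<^sup>2 / s i)" for u :: "real ^ 'n"
  define e :: "real ^ 'n" where "e = (\<chi> i. s i * z $ i)"
  have [measurable]: "Q \<in> borel_measurable borel" unfolding Q_def by measurable
  obtain j where "z $ j \<noteq> 0" using z by (auto simp: vec_eq_iff)
  then have "0 < s j * (z $ j)\<^sup>2" using s by simp
  also have "\<dots> \<le> S" unfolding S_def by (rule member_le_sum) (use s in \<open>auto simp: less_imp_le\<close>)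
  finally have S: "S > 0" .
  have ze: "z \<bullet> e = S"
    by (simp add: inner_vec_def e_def S_def power2_eq_square mult_ac)
  have ek: "e $ k = 0" by (simp add: e_def zk)
  define P where "P u = u - ((z \<bullet> u) / S) *\<^sub>R e" for u
  have [measurable]: "P \<in> borel_measurable borel" unfolding P_def by measurable
  have zP: "z \<bullet> P u = 0" for u using S by (simp add: P_def inner_diff_right ze)
  have Pk: "P u $ k = u $ k" for u by (simp add: P_def ek)
  \<comment> \<open>Since e_i / s_i = z_i, the cross term is a multiple of z . P u, which is
    zero.\<close>
  have QP: "Q (P u + t *\<^sub>R e) = Q (P u) + t\<^sup>2 * S" for u t
  proof -
    have "Q (P u + t *\<^sub>R e) = (\<Sum>i\<in>UNIV. (P u $ i)\<^sup>2 / s i + t\<^sup>2 * (s i * (z $ i)\<^sup>2) + 2 * t * (z $ i * P u $ i))"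
      unfolding Q_def
    proof (rule sum.cong[OF refl])
      fix i
      show "((P u + t *\<^sub>R e) $ i)\<^sup>2 / s i = (P u $ i)\<^sup>2 / s i + t\<^sup>2 * (s i * (z $ i)\<^sup>2) + 2 * t * (z $ i * P u $ i)"
        using s[of i] by (simp add: e_def field_simps power2_eq_square)
    qed
    also have "\<dots> = Q (P u) + t\<^sup>2 * S + 2 * t * (z \<bullet> P u)"
      by (simp add: sum.distrib Q_def S_def sum_distrib_left inner_vec_def)
    finally show ?thesis by (simp add: zP)
  qed
  \<comment> \<open>Lines parallel to \<open>e\<close>, each recentred at its point in the kernel of
    \<open>z\<close>.\<close>
  have slab: "(\<integral>\<^sup>+u. h u \<partial>lborel) = ennreal S * (\<integral>\<^sup>+u. indicator {0..1} (z \<bullet> u) * (\<integral>\<^sup>+t. h (P u + t *\<^sub>R e) \<partial>lborel) \<partial>lborel)"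
    if [measurable]: "h \<in> borel_measurable borel" for h
  proof -
    have "(\<integral>\<^sup>+t. h (u + t *\<^sub>R e) \<partial>lborel) = (\<integral>\<^sup>+t. h (P u + t *\<^sub>R e) \<partial>lborel)" for u
      using nn_integral_lborel_translate[of "\<lambda>t::real. h (u + t *\<^sub>R e)" "- ((z \<bullet> u) / S)"]
      by (simp add: P_def algebra_simps)
    then show ?thesis
      using S by (subst nn_integral_slab[of z e]) (simp_all add: ze nn_integral_cmult)
  qed
  \<comment> \<open>\<open>E t\<close> is the weight that \<phi> t receives once the variable along
    \<open>e\<close> has been turned into the argument of \<phi>.\<close>
  define E where "E t = (\<integral>\<^sup>+u. indicator {0..1} (z \<bullet> u) * ennreal (exp (- Q (P u) - t\<^sup>2 * (u $ k)\<^sup>2 / S)) \<partial>lborel)" for t :: real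
  have E: "E t = ennreal (D / pi) * (\<integral>\<^sup>+r. ennreal (exp (- (S + s k * t\<^sup>2) * r\<^sup>2)) \<partial>lborel)" for t
  proof -
    have pos: "S + s k * t\<^sup>2 > 0" using S s[of k] by (simp add: add_pos_nonneg)
    define a where "a i = 1 / s i + (if i = k then t\<^sup>2 / S else 0)" for i
    have a: "a i > 0" for i using s[of i] S by (simp add: a_def add_pos_nonneg)
    \<comment> \<open>To evaluate \<open>E t\<close>, the full Gaussian with the diagonal form Q u +
      t^2 u_k^2 / S is split along \<open>e\<close>: its integral is \<open>E t\<close> times
      \<open>S\<close> times the one-dimensional factor sqrt (pi / S).\<close>
    have Qa: "Q u + t\<^sup>2 * (u $ k)\<^sup>2 / S = (\<Sum>i\<in>UNIV. a i * (u $ i)\<^sup>2)" for u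
      by (simp add: a_def Q_def distrib_right sum.distrib if_distrib[where f="\<lambda>x. x * _"] cong: if_cong)
    have "ennreal (\<Prod>i\<in>UNIV. sqrt (pi / a i)) = (\<integral>\<^sup>+u. ennreal (exp (- (Q u + t\<^sup>2 * (u $ k)\<^sup>2 / S))) \<partial>lborel)"
      unfolding Qa by (rule nn_integral_gauss_vec[symmetric]) (rule a)
    also have "\<dots> = ennreal S * (\<integral>\<^sup>+u. indicator {0..1} (z \<bullet> u) *
        (\<integral>\<^sup>+\<tau>. ennreal (exp (- Q (P u) - t\<^sup>2 * (u $ k)\<^sup>2 / S)) * ennreal (exp (- S * \<tau>\<^sup>2)) \<partial>lborel) \<partial>lborel)"
      by (subst slab) (simp_all add: QP ek Pk ennreal_mult[symmetric] exp_add[symmetric] algebra_simps)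
    also have "\<dots> = ennreal S * (\<integral>\<^sup>+u. indicator {0..1} (z \<bullet> u) *
        ennreal (exp (- Q (P u) - t\<^sup>2 * (u $ k)\<^sup>2 / S)) * ennreal (sqrt (pi / S)) \<partial>lborel)"
      by (subst nn_integral_cmult) (simp_all only: nn_integral_gauss[OF S] mult.assoc, measurable)
    also have "\<dots> = ennreal S * (E t * ennreal (sqrt (pi / S)))"
      unfolding E_def by (subst nn_integral_multc) simp_all
    finally have Et: "ennreal (\<Prod>i\<in>UNIV. sqrt (pi / a i)) = ennreal S * (E t * ennreal (sqrt (pi / S)))" .
    have SS: "S * sqrt (pi / S) = sqrt (pi * S)"
    proof -
      have "sqrt (pi * S) = sqrt (S * S * (pi / S))" using S by simp
      also have "\<dots> = S * sqrt (pi / S)" using S by (simp only: real_sqrt_mult) simp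
      finally show ?thesis ..
    qed
    from Et have eq: "ennreal (\<Prod>i\<in>UNIV. sqrt (pi / a i)) = ennreal (sqrt (pi * S)) * E t"
      using S by (simp add: mult_ac ennreal_mult[symmetric] mult.assoc[symmetric] SS)
    \<comment> \<open>The added term alters only the factor with index k, by sqrt (S / (S + s_k
      t^2)).\<close>
    have "(\<Prod>i\<in>UNIV. sqrt (pi / a i)) = (\<Prod>i\<in>UNIV. sqrt (pi * s i) * (if i = k then sqrt S / sqrt (S + s k * t\<^sup>2) else 1))"
    proof (rule prod.cong[OF refl])
      fix i
      show "sqrt (pi / a i) = sqrt (pi * s i) * (if i = k then sqrt S / sqrt (S + s k * t\<^sup>2) else 1)"
      proof (cases "i = k")
        case True
        have "pi / a k = pi * s k * (S / (S + s k * t\<^sup>2))"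
          using s[of k] S pos by (simp add: a_def field_simps)
        then show ?thesis using True by (simp add: real_sqrt_mult real_sqrt_divide)
      qed (simp add: a_def)
    qed
    also have "\<dots> = D * (sqrt S / sqrt (S + s k * t\<^sup>2))"
      by (simp add: prod.distrib D_def)
    also have "\<dots> = sqrt (pi * S) * (D / pi * sqrt (pi / (S + s k * t\<^sup>2)))"
      using S pos by (simp add: real_sqrt_mult real_sqrt_divide field_simps)
    finally have "ennreal (sqrt (pi * S)) * E t = ennreal (sqrt (pi * S)) * ennreal (D / pi * sqrt (pi / (S + s k * t\<^sup>2)))"
      using eq S by (simp add: ennreal_mult'[symmetric])
    then have "E t = ennreal (D / pi * sqrt (pi / (S + s k * t\<^sup>2)))"
      using S by (simp add: ennreal_mult_cancel_left)
    also have "\<dots> = ennreal (D / pi) * ennreal (sqrt (pi / (S + s k * t\<^sup>2)))"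
      using pos by (intro ennreal_mult'') simp
    finally show ?thesis by (simp only: nn_integral_gauss[OF pos])
  qed
  \<comment> \<open>Substituting - (u_k / S) t for t makes the argument of \<phi> equal to t. The
    Jacobian |u_k| / S cancels both \<open>S\<close> and the weight 1 / |u_k|.\<close>
  have sub: "ennreal S * (\<integral>\<^sup>+t. ennreal (exp (- Q (P u + t *\<^sub>R e)) / \<bar>u $ k\<bar>) * \<phi> (- (t * S) / u $ k) \<partial>lborel)
      = (\<integral>\<^sup>+t. ennreal (exp (- Q (P u) - t\<^sup>2 * (u $ k)\<^sup>2 / S)) * \<phi> t \<partial>lborel)" if u: "u $ k \<noteq> 0" for u
  proof -
    have "(\<integral>\<^sup>+t. ennreal (exp (- Q (P u + t *\<^sub>R e)) / \<bar>u $ k\<bar>) * \<phi> (- (t * S) / u $ k) \<partial>lborel)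
      = ennreal \<bar>- (u $ k) / S\<bar> * (\<integral>\<^sup>+t. ennreal (exp (- Q (P u + (0 + (- (u $ k) / S) * t) *\<^sub>R e)) / \<bar>u $ k\<bar>)
          * \<phi> (- ((0 + (- (u $ k) / S) * t) * S) / u $ k) \<partial>lborel)"
      by (rule nn_integral_real_affine) (use S u in auto)
    also have "\<dots> = ennreal (\<bar>u $ k\<bar> / S) * (\<integral>\<^sup>+t. ennreal (1 / \<bar>u $ k\<bar>) * (ennreal (exp (- Q (P u) - t\<^sup>2 * (u $ k)\<^sup>2 / S)) * \<phi> t) \<partial>lborel)"
    proof -
      have "ennreal (exp (- Q (P u + (0 + (- (u $ k) / S) * t) *\<^sub>R e)) / \<bar>u $ k\<bar>) * \<phi> (- ((0 + (- (u $ k) / S) * t) * S) / u $ k)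
        = ennreal (1 / \<bar>u $ k\<bar>) * (ennreal (exp (- Q (P u) - t\<^sup>2 * (u $ k)\<^sup>2 / S)) * \<phi> t)" for t
      proof -
        have "- ((0 + (- (u $ k) / S) * t) * S) / u $ k = t" using S u by simp
        moreover have "- Q (P u + (0 + (- (u $ k) / S) * t) *\<^sub>R e) = - Q (P u) - t\<^sup>2 * (u $ k)\<^sup>2 / S"
          unfolding QP using S by (simp add: field_simps power2_eq_square)
        ultimately show ?thesis by (simp add: mult.assoc[symmetric] ennreal_mult'[symmetric])
      qed
      then show ?thesis using S by simp
    qed
    also have "\<dots> = ennreal (\<bar>u $ k\<bar> / S) * (ennreal (1 / \<bar>u $ k\<bar>) * (\<integral>\<^sup>+t. ennreal (exp (- Q (P u) - t\<^sup>2 * (u $ k)\<^sup>2 / S)) * \<phi> t \<partial>lborel))"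
      by (subst nn_integral_cmult) simp_all
    also have "ennreal S * \<dots> = (\<integral>\<^sup>+t. ennreal (exp (- Q (P u) - t\<^sup>2 * (u $ k)\<^sup>2 / S)) * \<phi> t \<partial>lborel)"
      using S u by (simp add: mult.assoc[symmetric] ennreal_mult'[symmetric])
    finally show ?thesis .
  qed
  have "(\<integral>\<^sup>+u. ennreal (exp (- Q u) / \<bar>u $ k\<bar>) * \<phi> (- (u \<bullet> z) / u $ k) \<partial>lborel)
    = ennreal S * (\<integral>\<^sup>+u. indicator {0..1} (z \<bullet> u) *
        (\<integral>\<^sup>+t. ennreal (exp (- Q (P u + t *\<^sub>R e)) / \<bar>u $ k\<bar>) * \<phi> (- (t * S) / u $ k) \<partial>lborel) \<partial>lborel)"
    by (subst slab) (simp_all add: ek Pk inner_add_left inner_commute[of _ z] zP inner_add_right ze)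
  also have "\<dots> = (\<integral>\<^sup>+u. indicator {0..1} (z \<bullet> u) *
        (ennreal S * (\<integral>\<^sup>+t. ennreal (exp (- Q (P u + t *\<^sub>R e)) / \<bar>u $ k\<bar>) * \<phi> (- (t * S) / u $ k) \<partial>lborel)) \<partial>lborel)"
    by (subst nn_integral_cmult[symmetric]) (simp_all add: mult_ac)
  also have "\<dots> = (\<integral>\<^sup>+u. indicator {0..1} (z \<bullet> u) *
        (\<integral>\<^sup>+t. ennreal (exp (- Q (P u) - t\<^sup>2 * (u $ k)\<^sup>2 / S)) * \<phi> t \<partial>lborel) \<partial>lborel)"
    by (rule nn_integral_cong_AE, rule AE_mp[OF AE_lborel_component_nonzero[of k]], rule AE_I2) (rule impI, rule arg_cong[where f="(*) _"], erule sub)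
  also have "\<dots> = (\<integral>\<^sup>+u. (\<integral>\<^sup>+t. indicator {0..1} (z \<bullet> u) * (ennreal (exp (- Q (P u) - t\<^sup>2 * (u $ k)\<^sup>2 / S)) * \<phi> t) \<partial>lborel) \<partial>lborel)"
    by (simp add: nn_integral_cmult)
  also have "\<dots> = (\<integral>\<^sup>+t. (\<integral>\<^sup>+u. indicator {0..1} (z \<bullet> u) * (ennreal (exp (- Q (P u) - t\<^sup>2 * (u $ k)\<^sup>2 / S)) * \<phi> t) \<partial>lborel) \<partial>lborel)"
    by (rule lborel_pair.Fubini') measurable
  also have "\<dots> = (\<integral>\<^sup>+t. \<phi> t * E t \<partial>lborel)"
    unfolding E_def by (rule nn_integral_cong) (subst nn_integral_cmult[symmetric], simp_all add: mult_ac)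
  finally show ?thesis
    unfolding E by (simp only: Q_def S_def D_def)
qed

text \<open>By \<open>nn_integral_hyperplane_oblique\<close> the inner integral on the left is a
  multiple of the section integral of \<open>F\<close>. For fixed x the projected point moves, as u
  varies, on the line through x along axis k, with the density given by
  \<open>gauss_ratio_distribution\<close>; \<open>nn_integral_slab\<close> reassembles these lines.
  The second index \<open>j\<close> ensures that almost no x lies on axis k.\<close>

lemma hyperplane_sections_gauss_mixture:
  fixes s :: "'n::finite \<Rightarrow> real" and F :: "real ^ 'n \<Rightarrow> ennreal"
  assumes s: "\<And>i. s i > 0" and jk: "j \<noteq> k" and [measurable]: "F \<in> borel_measurable borel"
  shows "(\<integral>\<^sup>+u. ennreal (exp (- (\<Sum>i\<in>UNIV. (u $ i)\<^sup>2 / s i)) / \<bar>u $ k\<bar>)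
        * (\<integral>\<^sup>+x. indicator {0..1} (x $ k) * F (x - (u \<bullet> x / u $ k) *\<^sub>R axis k 1) \<partial>lborel) \<partial>lborel)
    = ennreal ((\<Prod>i\<in>UNIV. sqrt (pi * s i)) / pi)
        * (\<integral>\<^sup>+x. F x * (\<integral>\<^sup>+r. ennreal (exp (- (\<Sum>i\<in>UNIV. s i * (x $ i)\<^sup>2) * r\<^sup>2)) \<partial>lborel) \<partial>lborel)"
proof -
  define w where "w u = ennreal (exp (- (\<Sum>i\<in>UNIV. (u $ i)\<^sup>2 / s i)) / \<bar>u $ k\<bar>)" for u :: "real ^ 'n"
  define c where "c = ennreal ((\<Prod>i\<in>UNIV. sqrt (pi * s i)) / pi)"
  define q where "q x = (\<Sum>i\<in>UNIV. s i * (x $ i)\<^sup>2)" for x :: "real ^ 'n"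
  define G where "G x = F x * (c * (\<integral>\<^sup>+r. ennreal (exp (- q x * r\<^sup>2)) \<partial>lborel))" for x
  have [measurable]: "w \<in> borel_measurable borel" unfolding w_def by measurable
  have [measurable]: "q \<in> borel_measurable borel" unfolding q_def by measurable
  have [measurable]: "G \<in> borel_measurable borel" unfolding G_def by measurable
  let ?e = "axis k 1 :: real ^ 'n"
  have inner: "(\<integral>\<^sup>+u. w u * F (x - (u \<bullet> x / u $ k) *\<^sub>R ?e) \<partial>lborel) = (\<integral>\<^sup>+t. G (x + t *\<^sub>R ?e) \<partial>lborel)"
    if "x $ j \<noteq> 0" for x
  proof -
    define z where "z = x - (x $ k) *\<^sub>R ?e"
    have zj: "z $ j = x $ j" using jk by (simp add: z_def axis_def)
    have zk: "z $ k = 0" by (simp add: z_def)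
    have z: "z \<noteq> 0" using zj that by auto
    have q: "q (z + t *\<^sub>R ?e) = q z + s k * t\<^sup>2" for t
    proof -
      have "s i * ((z + t *\<^sub>R ?e) $ i)\<^sup>2 = s i * (z $ i)\<^sup>2 + (if i = k then s k * t\<^sup>2 else 0)" for i
        using zk by (simp add: axis_def)
      then show ?thesis by (simp add: q_def sum.distrib)
    qed
    have "(\<integral>\<^sup>+u. w u * F (x - (u \<bullet> x / u $ k) *\<^sub>R ?e) \<partial>lborel)
      = (\<integral>\<^sup>+u. w u * F (z + (- (u \<bullet> z) / u $ k) *\<^sub>R ?e) \<partial>lborel)"
    proof (rule nn_integral_cong)
      fix u :: "real ^ 'n"
      show "w u * F (x - (u \<bullet> x / u $ k) *\<^sub>R ?e) = w u * F (z + (- (u \<bullet> z) / u $ k) *\<^sub>R ?e)"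
      \<comment> \<open>For u_k = 0 both sides vanish, because division by zero makes
        \<open>w u\<close> zero.\<close>
      proof (cases "u $ k = 0")
        case False
        then have "x - (u \<bullet> x / u $ k) *\<^sub>R ?e = z + (- (u \<bullet> z) / u $ k) *\<^sub>R ?e"
          by (simp add: z_def inner_diff_right inner_axis diff_divide_distrib algebra_simps)
        then show ?thesis by simp
      qed (simp add: w_def)
    qed
    also have "\<dots> = (\<integral>\<^sup>+t. F (z + t *\<^sub>R ?e) * (c * (\<integral>\<^sup>+r. ennreal (exp (- (q z + s k * t\<^sup>2) * r\<^sup>2)) \<partial>lborel)) \<partial>lborel)"
      unfolding w_def c_def q_def
      by (rule gauss_ratio_distribution[OF s zk z, of "\<lambda>t. F (z + t *\<^sub>R ?e)"]) measurable
    also have "\<dots> = (\<integral>\<^sup>+t. G (z + t *\<^sub>R ?e) \<partial>lborel)"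
      by (simp only: G_def q)
    also have "\<dots> = (\<integral>\<^sup>+t. G (x + t *\<^sub>R ?e) \<partial>lborel)"
      using nn_integral_lborel_translate[of "\<lambda>t::real. G (x + t *\<^sub>R ?e)" "- (x $ k)"]
      by (simp add: z_def algebra_simps)
    finally show ?thesis .
  qed
  have "(\<integral>\<^sup>+u. w u * (\<integral>\<^sup>+x. indicator {0..1} (x $ k) * F (x - (u \<bullet> x / u $ k) *\<^sub>R ?e) \<partial>lborel) \<partial>lborel)
    = (\<integral>\<^sup>+u. (\<integral>\<^sup>+x. indicator {0..1} (x $ k) * (w u * F (x - (u \<bullet> x / u $ k) *\<^sub>R ?e)) \<partial>lborel) \<partial>lborel)"
    by (rule nn_integral_cong) (subst nn_integral_cmult[symmetric], simp_all add: mult_ac)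
  also have "\<dots> = (\<integral>\<^sup>+x. (\<integral>\<^sup>+u. indicator {0..1} (x $ k) * (w u * F (x - (u \<bullet> x / u $ k) *\<^sub>R ?e)) \<partial>lborel) \<partial>lborel)"
    by (rule lborel_pair.Fubini') measurable
  also have "\<dots> = (\<integral>\<^sup>+x. indicator {0..1} (x $ k) * (\<integral>\<^sup>+u. w u * F (x - (u \<bullet> x / u $ k) *\<^sub>R ?e) \<partial>lborel) \<partial>lborel)"
    by (rule nn_integral_cong) (rule nn_integral_cmult, measurable)
  also have "\<dots> = (\<integral>\<^sup>+x. indicator {0..1} (x $ k) * (\<integral>\<^sup>+t. G (x + t *\<^sub>R ?e) \<partial>lborel) \<partial>lborel)"
    by (rule nn_integral_cong_AE, rule AE_mp[OF AE_lborel_component_nonzero[of j]], rule AE_I2) (rule impI, rule arg_cong[where f="(*) _"], erule inner)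
  also have "\<dots> = (\<integral>\<^sup>+x. (\<integral>\<^sup>+t. indicator {0..1} (?e \<bullet> x) * G (x + t *\<^sub>R ?e) \<partial>lborel) \<partial>lborel)"
    by (rule nn_integral_cong) (subst nn_integral_cmult, simp_all add: inner_axis')
  also have "\<dots> = (\<integral>\<^sup>+x. G x \<partial>lborel)"
    by (subst nn_integral_slab[of ?e ?e G]) (simp_all add: inner_axis_axis)
  also have "\<dots> = c * (\<integral>\<^sup>+x. F x * (\<integral>\<^sup>+r. ennreal (exp (- q x * r\<^sup>2)) \<partial>lborel) \<partial>lborel)"
    unfolding G_def by (subst nn_integral_cmult[symmetric]) (simp_all add: mult_ac)
  finally show ?thesis by (simp only: w_def c_def q_def)
qed

section \<open>Mixtures of Gaussians\<close>

definition gauss :: "('n::finite \<Rightarrow> real) \<Rightarrow> real ^ 'n \<Rightarrow> ennreal" where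
  "gauss s x = ennreal (exp (- (\<Sum>i\<in>UNIV. s i * (x $ i)\<^sup>2)))"

lemma gauss_measurable [measurable]: "gauss s \<in> borel_measurable borel"
  unfolding gauss_def by measurable

lemma gauss_mult: "gauss s x * gauss t x = gauss (\<lambda>i. s i + t i) x"
  by (simp add: gauss_def ennreal_mult[symmetric] exp_add[symmetric] sum.distrib algebra_simps)

inductive gauss_mixture :: "(real ^ 'n \<Rightarrow> ennreal) \<Rightarrow> bool" where
  gauss: "(\<And>i. s i \<ge> 0) \<Longrightarrow> gauss_mixture (gauss s)"
| cmult: "gauss_mixture g \<Longrightarrow> gauss_mixture (\<lambda>x. c * g x)"
| suminf: "(\<And>j. gauss_mixture (g j)) \<Longrightarrow> gauss_mixture (\<lambda>x. \<Sum>j::nat. g j x)"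

lemma gauss_mixture_measurable: "gauss_mixture g \<Longrightarrow> g \<in> borel_measurable borel"
proof (induction rule: gauss_mixture.induct)
  case (suminf g)
  note [measurable] = suminf.IH
  show ?case by measurable
qed simp_all

lemma gauss_mixture_const: "gauss_mixture (\<lambda>_. c)"
  using gauss_mixture.cmult[OF gauss_mixture.gauss[of "\<lambda>_. 0"], of c] by (simp add: gauss_def)

text \<open>Exponents of Gaussians add under multiplication, and the product distributes over
  countable sums in each factor.\<close>

lemma gauss_mixture_mult:
  assumes "gauss_mixture g" "gauss_mixture h"
  shows "gauss_mixture (\<lambda>x. g x * h x)"
  using assms(1)
proof induction
  case s: (gauss s)
  from assms(2) show ?case
  proof induction
    case (gauss t)
    then show ?case using s by (simp add: gauss_mult gauss_mixture.gauss)
  next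
    case (cmult h c)
    from gauss_mixture.cmult[OF cmult.IH, of c] show ?case by (simp add: mult_ac)
  next
    case (suminf h)
    from gauss_mixture.suminf[OF suminf.IH] show ?case by simp
  qed
next
  case (cmult g c)
  from gauss_mixture.cmult[OF cmult.IH, of c] show ?case by (simp add: mult_ac)
next
  case (suminf g)
  from gauss_mixture.suminf[OF suminf.IH] show ?case by simp
qed

lemma gauss_mixture_power: "gauss_mixture g \<Longrightarrow> gauss_mixture (\<lambda>x. g x ^ m)"
  by (induction m) (simp_all add: gauss_mixture_const gauss_mixture_mult)

lemma gauss_mixture_prod:
  "finite A \<Longrightarrow> (\<And>i. i \<in> A \<Longrightarrow> gauss_mixture (g i)) \<Longrightarrow> gauss_mixture (\<lambda>x. \<Prod>i\<in>A. g i x)"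
  by (induction rule: finite_induct) (simp_all add: gauss_mixture_const gauss_mixture_mult)

text \<open>The exponential series has positive coefficients, and powers of a mixture are
  mixtures.\<close>

lemma gauss_mixture_exp:
  assumes "gauss_mixture (\<lambda>x. ennreal (f x))" and f: "\<And>x. f x \<ge> 0"
  shows "gauss_mixture (\<lambda>x. ennreal (exp (f x)))"
proof -
  have "ennreal (exp (f x)) = (\<Sum>m. ennreal (1 / fact m) * ennreal (f x) ^ m)" for x
  proof -
    have "(\<lambda>m. f x ^ m /\<^sub>R fact m) sums exp (f x)" by (rule exp_converges)
    then have "(\<lambda>m. ennreal (f x ^ m /\<^sub>R fact m)) sums ennreal (exp (f x))"
      using f[of x] by simp
    then have "ennreal (exp (f x)) = (\<Sum>m. ennreal (f x ^ m /\<^sub>R fact m))" by (rule sums_unique)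
    also have "\<dots> = (\<Sum>m. ennreal (1 / fact m) * ennreal (f x) ^ m)"
      using f[of x] by (simp add: ennreal_power ennreal_mult[symmetric] divide_inverse)
    finally show ?thesis .
  qed
  moreover have "gauss_mixture (\<lambda>x. \<Sum>m. ennreal (1 / fact m) * ennreal (f x) ^ m)"
    by (intro gauss_mixture.suminf gauss_mixture.cmult gauss_mixture_power assms)
  ultimately show ?thesis by simp
qed

text \<open>Passing from n to n + 1 multiplies the quantity by (n + 1 - \<alpha>) / (n + 2), which
  is nonnegative for \<alpha> \<le> 1. This is where the bound p \<le> 2 enters.\<close>

lemma gbinomial_sign:
  fixes \<alpha> :: real
  assumes "0 \<le> \<alpha>" "\<alpha> \<le> 1"
  shows "0 \<le> (-1) ^ n * (\<alpha> gchoose Suc n)"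
proof (induction n)
  case (Suc n)
  have "real (Suc (Suc n)) * (\<alpha> gchoose Suc (Suc n)) = (\<alpha> - real (Suc n)) * (\<alpha> gchoose Suc n)"
    using gbinomial_mult_1[of \<alpha> "Suc n"] by (simp add: algebra_simps)
  then have "(-1) ^ Suc n * (real (Suc (Suc n)) * (\<alpha> gchoose Suc (Suc n)))
    = (-1) ^ Suc n * ((\<alpha> - real (Suc n)) * (\<alpha> gchoose Suc n))"
    by (rule arg_cong)
  also have "\<dots> = (real (Suc n) - \<alpha>) * ((-1) ^ n * (\<alpha> gchoose Suc n))"
    by (simp add: algebra_simps)
  finally have "real (Suc (Suc n)) * ((-1) ^ Suc n * (\<alpha> gchoose Suc (Suc n)))
    = (real (Suc n) - \<alpha>) * ((-1) ^ n * (\<alpha> gchoose Suc n))"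
    by (simp only: mult_ac)
  also have "\<dots> \<ge> 0" by (rule mult_nonneg_nonneg[OF _ Suc]) (use assms in simp)
  finally show ?case by (simp only: zero_le_mult_iff) auto
qed (use assms in simp)

lemma one_minus_powr_series:
  fixes z \<alpha> :: real
  assumes "0 \<le> z" "z < 1"
  shows "(\<lambda>n. (-1) ^ n * (\<alpha> gchoose Suc n) * z ^ Suc n) sums (1 - (1 - z) powr \<alpha>)"
proof -
  have "(\<lambda>n. (\<alpha> gchoose n) * (- z) ^ n) sums (1 + (- z)) powr \<alpha>"
    using assms by (intro gen_binomial_real) auto
  \<comment> \<open>The constant term of the binomial series is 1; it is split off.\<close>
  then have "(\<lambda>n. (\<alpha> gchoose Suc n) * (- z) ^ Suc n) sums ((1 - z) powr \<alpha> - 1)"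
    by (subst sums_Suc_iff) simp
  then have "(\<lambda>n. - ((\<alpha> gchoose Suc n) * (- z) ^ Suc n)) sums - ((1 - z) powr \<alpha> - 1)"
    by (rule sums_minus)
  moreover have "- ((\<alpha> gchoose Suc n) * (- z) ^ Suc n) = (-1) ^ n * (\<alpha> gchoose Suc n) * z ^ Suc n" for n
    by (subst power_minus) simp
  ultimately show ?thesis by (simp only: minus_diff_eq)
qed

lemma gauss_mixture_one_minus_powr:
  fixes g :: "real ^ 'n \<Rightarrow> real"
  assumes \<alpha>: "0 \<le> \<alpha>" "\<alpha> \<le> 1" and g: "\<And>x. 0 \<le> g x" "\<And>x. g x < 1"
    and "gauss_mixture (\<lambda>x. ennreal (g x))"
  shows "gauss_mixture (\<lambda>x. ennreal (1 - (1 - g x) powr \<alpha>))"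
proof -
  have "ennreal (1 - (1 - g x) powr \<alpha>) = (\<Sum>n. ennreal ((-1) ^ n * (\<alpha> gchoose Suc n)) * ennreal (g x) ^ Suc n)" for x
  proof -
    have nn: "1 - (1 - g x) powr \<alpha> \<ge> 0" using g[of x] \<alpha> by (simp add: powr_le1)
    have "0 \<le> (-1) ^ n * (\<alpha> gchoose Suc n) * g x ^ Suc n" for n
      by (rule mult_nonneg_nonneg[OF gbinomial_sign[OF \<alpha>]]) (use g[of x] in simp)
    then have "(\<lambda>n. ennreal ((-1) ^ n * (\<alpha> gchoose Suc n) * g x ^ Suc n)) sums ennreal (1 - (1 - g x) powr \<alpha>)"
      using one_minus_powr_series[OF g, of \<alpha> x] nn by simp
    then have "ennreal (1 - (1 - g x) powr \<alpha>) = (\<Sum>n. ennreal ((-1) ^ n * (\<alpha> gchoose Suc n) * g x ^ Suc n))"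
      by (rule sums_unique)
    also have "\<dots> = (\<Sum>n. ennreal ((-1) ^ n * (\<alpha> gchoose Suc n)) * ennreal (g x) ^ Suc n)"
      using gbinomial_sign[OF \<alpha>] g(1)[of x] by (simp only: ennreal_power ennreal_mult zero_le_power)
    finally show ?thesis .
  qed
  moreover have "gauss_mixture (\<lambda>x. \<Sum>n. ennreal ((-1) ^ n * (\<alpha> gchoose Suc n)) * ennreal (g x) ^ Suc n)"
    by (intro gauss_mixture.suminf gauss_mixture.cmult gauss_mixture_power assms)
  ultimately show ?thesis by simp
qed

text \<open>
  The exponent is \<open>\<kappa> - \<kappa> (1 - (1 - z)\<^sup>\<alpha>)\<close> with \<open>\<kappa> = \<delta> powr - \<alpha>\<close>, and it tends to \<open>\<bar>x\<^sub>i\<bar> powr (2 * \<alpha>)\<close>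
  as \<open>\<delta> \<rightarrow> 0\<close> and \<open>\<eta> \<rightarrow> 1\<close> fast enough; \<open>\<eta> < 1\<close> keeps \<open>z\<close> inside the disc of convergence when \<open>x\<^sub>i = 0\<close>.
\<close>

lemma gauss_mixture_stable_approx:
  fixes \<alpha> \<eta> \<delta> :: real
  assumes \<alpha>: "0 \<le> \<alpha>" "\<alpha> \<le> 1" and \<eta>: "0 < \<eta>" "\<eta> < 1" and \<delta>: "0 < \<delta>"
  shows "gauss_mixture (\<lambda>x :: real ^ 'n.
    ennreal (exp (- (\<Sum>i\<in>UNIV. ((1 - \<eta> * exp (- \<delta> * (x $ i)\<^sup>2)) / \<delta>) powr \<alpha>))))"
proof -
  define z where "z i x = \<eta> * exp (- \<delta> * (x $ i)\<^sup>2)" for i and x :: "real ^ 'n"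
  define \<kappa> where "\<kappa> = \<delta> powr - \<alpha>"
  have z: "0 \<le> z i x" "z i x < 1" for i x
  proof -
    show "0 \<le> z i x" using \<eta> by (simp add: z_def)
    have "z i x \<le> \<eta> * 1" unfolding z_def using \<eta> \<delta> by (intro mult_left_mono) auto
    then show "z i x < 1" using \<eta> by simp
  qed
  have zmix: "gauss_mixture (\<lambda>x. ennreal (z i x))" for i
  proof -
    have "gauss (\<lambda>j. if j = i then \<delta> else 0) x = ennreal (exp (- \<delta> * (x $ i)\<^sup>2))" for x :: "real ^ 'n"
      by (simp add: gauss_def if_distrib[where f="\<lambda>t. t * _"] cong: if_cong)
    then have "ennreal (z i x) = ennreal \<eta> * gauss (\<lambda>j. if j = i then \<delta> else 0) x" for x
      using \<eta> by (simp add: z_def ennreal_mult)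
    moreover have "gauss_mixture (\<lambda>x. ennreal \<eta> * gauss (\<lambda>j. if j = i then \<delta> else 0) x)"
      using \<delta> by (intro gauss_mixture.cmult gauss_mixture.gauss) simp
    ultimately show ?thesis by simp
  qed
  have f: "0 \<le> 1 - (1 - z i x) powr \<alpha>" for i x
    using z[of i x] \<alpha> by (simp add: powr_le1)
  have "gauss_mixture (\<lambda>x. ennreal \<kappa> * ennreal (1 - (1 - z i x) powr \<alpha>))" for i
    by (intro gauss_mixture.cmult gauss_mixture_one_minus_powr \<alpha> z zmix)
  then have "gauss_mixture (\<lambda>x. ennreal (\<kappa> * (1 - (1 - z i x) powr \<alpha>)))" for i
    using f by (simp add: ennreal_mult \<kappa>_def)
  then have "gauss_mixture (\<lambda>x. ennreal (exp (\<kappa> * (1 - (1 - z i x) powr \<alpha>))))" for i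
    by (rule gauss_mixture_exp) (use f in \<open>simp add: \<kappa>_def\<close>)
  then have *: "gauss_mixture (\<lambda>x. \<Prod>i\<in>UNIV. ennreal (exp (- \<kappa>)) * ennreal (exp (\<kappa> * (1 - (1 - z i x) powr \<alpha>))))"
    by (intro gauss_mixture_prod gauss_mixture.cmult) auto
  have "((1 - z i x) / \<delta>) powr \<alpha> = \<kappa> * (1 - z i x) powr \<alpha>" for i x
    using z[of i x] \<delta> by (simp add: powr_divide \<kappa>_def powr_minus field_simps)
  then have "ennreal (exp (- \<kappa>)) * ennreal (exp (\<kappa> * (1 - (1 - z i x) powr \<alpha>))) = ennreal (exp (- (((1 - z i x) / \<delta>) powr \<alpha>)))" for i x
    by (simp add: ennreal_mult[symmetric] exp_add[symmetric] algebra_simps)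
  then have "(\<Prod>i\<in>UNIV. ennreal (exp (- \<kappa>)) * ennreal (exp (\<kappa> * (1 - (1 - z i x) powr \<alpha>))))
    = ennreal (exp (- (\<Sum>i\<in>UNIV. ((1 - z i x) / \<delta>) powr \<alpha>)))" for x
    by (simp add: prod_ennreal exp_sum[symmetric] sum_negf)
  with * show ?thesis by (simp add: z_def)
qed

text \<open>Integrating over all dilations makes a function homogeneous of degree -1: away from the
  origin \<open>gauss s\<close> yields a constant over the square root of its quadratic form, and
  the exponential of minus the p-th power of \<open>lp_norm p\<close> a constant over
  \<open>lp_norm p\<close>.\<close>

definition radial_pairing :: "('a::euclidean_space \<Rightarrow> ennreal) \<Rightarrow> ('a \<Rightarrow> ennreal) \<Rightarrow> ennreal" where
  "radial_pairing F g = (\<integral>\<^sup>+x. F x * (\<integral>\<^sup>+r. g (r *\<^sub>R x) \<partial>lborel) \<partial>lborel)"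

section \<open>Linearity, monotonicity and limits of the pairing\<close>

lemma radial_pairing_cmult:
  assumes [measurable]: "F \<in> borel_measurable borel" "g \<in> borel_measurable borel"
  shows "radial_pairing F (\<lambda>x. c * g x) = c * radial_pairing F g"
  unfolding radial_pairing_def
  by (subst (3) nn_integral_cmult[symmetric]) (simp_all add: nn_integral_cmult mult_ac)

lemma radial_pairing_suminf:
  assumes [measurable]: "F \<in> borel_measurable borel" "\<And>j. g j \<in> borel_measurable borel"
  shows "radial_pairing F (\<lambda>x. \<Sum>j. g j x) = (\<Sum>j. radial_pairing F (g j))"
  unfolding radial_pairing_def
  by (subst nn_integral_suminf, measurable) (simp add: ennreal_suminf_cmult[symmetric] nn_integral_suminf del: ennreal_suminf_cmult)

text \<open>The pairing commutes with scaling and countable sums, so the inequality extends by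
  induction. The additional factor \<open>gauss t\<close> makes all exponents strictly positive, as
  \<open>le\<close> requires.\<close>

lemma radial_pairing_mixture_le:
  fixes F1 F2 :: "real ^ 'n \<Rightarrow> ennreal"
  assumes [measurable]: "F1 \<in> borel_measurable borel" "F2 \<in> borel_measurable borel"
    and le: "\<And>s. (\<And>i. s i > 0) \<Longrightarrow> radial_pairing F1 (gauss s) \<le> radial_pairing F2 (gauss s)"
    and "gauss_mixture g" and t: "\<And>i. t i > 0"
  shows "radial_pairing F1 (\<lambda>x. g x * gauss t x) \<le> radial_pairing F2 (\<lambda>x. g x * gauss t x)"
  using assms(4)
proof induction
  case (gauss s)
  show ?case unfolding gauss_mult by (rule le) (use gauss t in \<open>simp add: add_nonneg_pos\<close>)
next
  case (cmult g c)
  note [measurable] = gauss_mixture_measurable[OF cmult.hyps]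
  show ?case using mult_left_mono[OF cmult.IH, of c] by (simp add: mult.assoc radial_pairing_cmult)
next
  case (suminf g)
  note [measurable] = gauss_mixture_measurable[OF suminf.hyps]
  show ?case using suminf.IH
    by (simp add: ennreal_suminf_multc[symmetric] radial_pairing_suminf suminf_le del: ennreal_suminf_multc)
qed

text \<open>The iterated integral is an integral over pairs (x, r), where dominated convergence
  applies. Finiteness of \<open>F\<close> makes multiplication by its values continuous on
  \<open>ennreal\<close>.\<close>

lemma radial_pairing_dominated_convergence:
  fixes F :: "'a::euclidean_space \<Rightarrow> ennreal"
  assumes [measurable]: "F \<in> borel_measurable borel" "\<And>m. g m \<in> borel_measurable borel"
      "g' \<in> borel_measurable borel" "h \<in> borel_measurable borel"
    and le: "\<And>m x. g m x \<le> h x" and fin: "radial_pairing F h < \<infinity>"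
    and lim: "\<And>x. (\<lambda>m. g m x) \<longlonglongrightarrow> g' x" and F: "\<And>x. F x < \<infinity>"
  shows "(\<lambda>m. radial_pairing F (g m)) \<longlonglongrightarrow> radial_pairing F g'"
proof -
  have eq: "radial_pairing F f = (\<integral>\<^sup>+z. F (fst z) * f (snd z *\<^sub>R fst z) \<partial>(lborel \<Otimes>\<^sub>M lborel))"
    if [measurable]: "f \<in> borel_measurable borel" for f
    unfolding radial_pairing_def
    by (subst lborel.nn_integral_fst[symmetric]) (simp_all add: nn_integral_cmult)
  show ?thesis
    using fin unfolding eq[OF assms(2)] eq[OF assms(3)] eq[OF assms(4)]
    by (intro nn_integral_dominated_convergence[where w="\<lambda>z. F (fst z) * h (snd z *\<^sub>R fst z)"])
      (use F in \<open>auto intro!: AE_I2 mult_left_mono le ennreal_tendsto_cmult lim\<close>)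
qed

section \<open>The weight \<open>\<parallel>x\<parallel>\<^sub>p\<close>\<close>

text \<open>Up to one common positive constant, both pairings are integrals of the hyperplane
  integrals over u with nonnegative weights, so the inequality for each hyperplane
  integrates.\<close>

lemma radial_pairing_gauss_le:
  fixes F1 F2 :: "real ^ 'n \<Rightarrow> ennreal"
  assumes [measurable]: "F1 \<in> borel_measurable borel" "F2 \<in> borel_measurable borel"
    and card: "CARD('n) \<ge> 2" and s: "\<And>i. s i > 0"
    and le: "\<And>\<xi>. norm \<xi> = 1 \<Longrightarrow> (\<integral>\<^sup>+x. F1 x \<partial>subspace_lborel {x. \<xi> \<bullet> x = 0})
      \<le> (\<integral>\<^sup>+x. F2 x \<partial>subspace_lborel {x. \<xi> \<bullet> x = 0})"
  shows "radial_pairing F1 (gauss s) \<le> radial_pairing F2 (gauss s)"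
proof -
  obtain k :: 'n where True by simp
  have "\<exists>j. j \<noteq> k"
  proof (rule ccontr)
    assume "\<not> ?thesis"
    then have "(UNIV :: 'n set) = {k}" by auto
    then have "CARD('n) = card {k}" by (rule arg_cong)
    with card show False by simp
  qed
  then obtain j where jk: "j \<noteq> k" by blast
  \<comment> \<open>For u_k nonzero this is |u_k| / |u| times the integral of \<open>F\<close> over
    the hyperplane orthogonal to u.\<close>
  define Sec where "Sec F u = (\<integral>\<^sup>+x. indicator {0..1} (x $ k) * F (x - (u \<bullet> x / u $ k) *\<^sub>R axis k 1) \<partial>lborel)"
    for F :: "real ^ 'n \<Rightarrow> ennreal" and u
  let ?w = "\<lambda>u :: real ^ 'n. ennreal (exp (- (\<Sum>i\<in>UNIV. (u $ i)\<^sup>2 / s i)) / \<bar>u $ k\<bar>)"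
  have Sec_le: "Sec F1 u \<le> Sec F2 u" if u: "u $ k \<noteq> 0" for u
  proof -
    define \<xi> where "\<xi> = u /\<^sub>R norm u"
    have u0: "u \<noteq> 0" using u by auto
    then have \<xi>: "norm \<xi> = 1" by (simp add: \<xi>_def)
    have e: "\<xi> \<bullet> axis k 1 = u $ k / norm u" by (simp add: \<xi>_def inner_axis divide_inverse mult.commute)
    have "Sec F u = ennreal \<bar>\<xi> \<bullet> axis k 1\<bar> * (\<integral>\<^sup>+x. F x \<partial>subspace_lborel {x. \<xi> \<bullet> x = 0})"
      if [measurable]: "F \<in> borel_measurable borel" for F
    proof -
      have "\<xi> \<bullet> x / (\<xi> \<bullet> axis k 1) = u \<bullet> x / u $ k" for x
        unfolding e using u0 by (simp add: \<xi>_def field_simps)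
      then show ?thesis
        using nn_integral_hyperplane_oblique[OF \<xi>, of "axis k 1" "axis k 1" F] u u0
        by (simp add: Sec_def e inner_axis_axis inner_axis')
    qed
    then show ?thesis using le[OF \<xi>] by (simp add: mult_left_mono)
  qed
  have rp: "radial_pairing F (gauss s)
      = (\<integral>\<^sup>+x. F x * (\<integral>\<^sup>+r. ennreal (exp (- (\<Sum>i\<in>UNIV. s i * (x $ i)\<^sup>2) * r\<^sup>2)) \<partial>lborel) \<partial>lborel)" for F
    by (simp add: radial_pairing_def gauss_def power_mult_distrib sum_distrib_left mult_ac)
  have "0 < (\<Prod>i\<in>UNIV. sqrt (pi * s i)) / pi"
    using s by (intro divide_pos_pos prod_pos) auto
  then have D: "ennreal ((\<Prod>i\<in>UNIV. sqrt (pi * s i)) / pi) \<noteq> 0"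
    by (simp only: ennreal_eq_0_iff not_le)
  have "ennreal ((\<Prod>i\<in>UNIV. sqrt (pi * s i)) / pi) * radial_pairing F1 (gauss s) = (\<integral>\<^sup>+u. ?w u * Sec F1 u \<partial>lborel)"
    unfolding rp Sec_def by (rule hyperplane_sections_gauss_mixture[symmetric, OF s jk]) measurable
  also have "\<dots> \<le> (\<integral>\<^sup>+u. ?w u * Sec F2 u \<partial>lborel)"
  proof (rule nn_integral_mono)
    fix u :: "real ^ 'n"
    show "?w u * Sec F1 u \<le> ?w u * Sec F2 u"
      \<comment> \<open>At u_k = 0 the weight is zero by the convention for division.\<close>
      by (cases "u $ k = 0") (auto intro: mult_left_mono Sec_le)
  qed
  also have "\<dots> = ennreal ((\<Prod>i\<in>UNIV. sqrt (pi * s i)) / pi) * radial_pairing F2 (gauss s)"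
    unfolding rp Sec_def by (rule hyperplane_sections_gauss_mixture[OF s jk]) measurable
  finally show ?thesis
    using D by (subst (asm) ennreal_mult_le_mult_iff) simp_all
qed

lemma nn_integral_exp_powr_finite:
  fixes p :: real
  assumes p: "0 < p"
  shows "(\<integral>\<^sup>+r. ennreal (exp (- (\<bar>r\<bar> powr p))) \<partial>lborel) < \<infinity>"
proof -
  \<comment> \<open>This \<open>m\<close> makes r^2 at most the m-th power of |r|^p for |r| > 1, and
    that power is at most m! exp (|r|^p). Hence the integrand is bounded by a multiple of 1 / (1 +
    r^2).\<close>
  obtain m :: nat where "2 / p \<le> real m" using real_arch_simple by blast
  then have m: "2 \<le> p * real m" using p by (simp add: field_simps)
  have bound: "exp (- (\<bar>r\<bar> powr p)) \<le> 2 * fact m * inverse (1 + r\<^sup>2)" for r :: real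
  proof -
    have pos: "0 < 1 + r\<^sup>2" by (simp add: add_pos_nonneg)
    have "1 + r\<^sup>2 \<le> 2 * fact m * exp (\<bar>r\<bar> powr p)"
    proof (cases "\<bar>r\<bar> \<le> 1")
      case True
      then have "1 + r\<^sup>2 \<le> 2 * 1 * 1" by (simp add: abs_square_le_1)
      also have "\<dots> \<le> 2 * fact m * exp (\<bar>r\<bar> powr p)"
        by (intro mult_mono) (auto simp: fact_ge_1)
      finally show ?thesis .
    next
      case False
      have "r\<^sup>2 = \<bar>r\<bar> powr 2" using False by simp
      also have "\<dots> \<le> \<bar>r\<bar> powr (p * real m)" using False m by (intro powr_mono) auto
      also have "\<dots> = (\<bar>r\<bar> powr p) ^ m" using False by (simp add: powr_powr[symmetric] powr_realpow)
      also have "\<dots> \<le> fact m * exp (\<bar>r\<bar> powr p)"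
      proof -
        have "(\<bar>r\<bar> powr p) ^ m /\<^sub>R fact m \<le> (\<Sum>n. (\<bar>r\<bar> powr p) ^ n /\<^sub>R fact n)"
          using sum_le_suminf[OF summable_exp_generic, of "{m}" "\<bar>r\<bar> powr p"] by simp
        then show ?thesis by (simp add: exp_def field_simps)
      qed
      finally have "r\<^sup>2 \<le> fact m * exp (\<bar>r\<bar> powr p)" .
      moreover have "1 \<le> r\<^sup>2" using False by (simp add: abs_square_less_1 not_less[symmetric])
      ultimately show ?thesis by linarith
    qed
    then show ?thesis using pos by (simp add: exp_minus field_simps)
  qed
  have "integrable lborel (\<lambda>r::real. 2 * fact m * inverse (1 + r\<^sup>2))"
    using integrable_inverse_1_plus_square by (simp add: set_integrable_def einterval_eq)
  then have "integrable lborel (\<lambda>r::real. exp (- (\<bar>r\<bar> powr p)))"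
    by (rule Bochner_Integration.integrable_bound) (auto intro!: AE_I2 order_trans[OF bound])
  then show ?thesis by (simp add: integrable_iff_bounded)
qed

section \<open>Positivity and growth of \<open>lp_norm\<close>, and its pairings\<close>

lemma lp_norm_powr:
  assumes "0 < p"
  shows "lp_norm p x powr p = (\<Sum>i\<in>UNIV. \<bar>x $ i\<bar> powr p)"
  using assms by (simp add: lp_norm_def powr_powr sum_nonneg)

lemma lp_norm_pos:
  assumes "x \<noteq> 0"
  shows "0 < lp_norm p x"
proof -
  obtain i where "x $ i \<noteq> 0" using assms by (auto simp: vec_eq_iff)
  then have "0 < (\<Sum>i\<in>UNIV. \<bar>x $ i\<bar> powr p)" by (intro sum_pos2[of _ i]) auto
  then show ?thesis by (simp add: lp_norm_def)
qed

lemma lp_norm_le: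
  fixes x :: "real ^ 'n"
  assumes p: "0 < p"
  shows "lp_norm p x \<le> real CARD('n) powr (1 / p) * norm x"
proof -
  have "(\<Sum>i\<in>UNIV. \<bar>x $ i\<bar> powr p) \<le> (\<Sum>i\<in>(UNIV :: 'n set). norm x powr p)"
    using p by (intro sum_mono powr_mono2) (auto simp: component_le_norm_cart)
  also have "\<dots> = real CARD('n) * norm x powr p" by simp
  finally have "lp_norm p x \<le> (real CARD('n) * norm x powr p) powr (1 / p)"
    unfolding lp_norm_def using p by (intro powr_mono2) (auto intro: sum_nonneg)
  also have "\<dots> = real CARD('n) powr (1 / p) * norm x"
    using p by (simp add: powr_mult powr_powr)
  finally show ?thesis .
qed

lemma lp_norm_measurable [measurable]: "lp_norm p \<in> borel_measurable borel"
  unfolding lp_norm_def by measurable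

lemma AE_lborel_nonzero: "AE x in (lborel :: 'a::euclidean_space measure). x \<noteq> 0"
  by (rule AE_I'[where N="{0}"]) auto

text \<open>At r x the exponent is minus the p-th power of |r| times \<open>lp_norm p x\<close>.
  Rescaling r leaves a constant over \<open>lp_norm p x\<close>, which cancels the weight, and the
  volume remains.\<close>

lemma radial_pairing_lp:
  fixes K :: "(real ^ 'n) set"
  assumes p: "0 < p" and [measurable]: "K \<in> sets borel"
  shows "radial_pairing (\<lambda>x. indicator K x * ennreal (lp_norm p x)) (\<lambda>x. ennreal (exp (- (\<Sum>i\<in>UNIV. \<bar>x $ i\<bar> powr p))))
    = (\<integral>\<^sup>+r. ennreal (exp (- (\<bar>r\<bar> powr p))) \<partial>lborel) * emeasure lborel K"
proof -
  let ?C = "\<integral>\<^sup>+r. ennreal (exp (- (\<bar>r\<bar> powr p))) \<partial>lborel"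
  have C: "ennreal (lp_norm p x) * (\<integral>\<^sup>+r. ennreal (exp (- (\<Sum>i\<in>UNIV. \<bar>(r *\<^sub>R x) $ i\<bar> powr p))) \<partial>lborel) = ?C"
    if "x \<noteq> 0" for x :: "real ^ 'n"
  proof -
    have N: "0 < lp_norm p x" using that by (rule lp_norm_pos)
    have "(\<Sum>i\<in>UNIV. \<bar>(r *\<^sub>R x) $ i\<bar> powr p) = \<bar>lp_norm p x * r\<bar> powr p" for r
    proof -
      have "(\<Sum>i\<in>UNIV. \<bar>(r *\<^sub>R x) $ i\<bar> powr p) = \<bar>r\<bar> powr p * lp_norm p x powr p"
        by (simp add: abs_mult powr_mult sum_distrib_left lp_norm_powr[OF p])
      also have "\<dots> = \<bar>lp_norm p x * r\<bar> powr p" using N by (simp add: abs_mult powr_mult mult.commute)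
      finally show ?thesis .
    qed
    then show ?thesis
      using nn_integral_real_affine[of "\<lambda>r. ennreal (exp (- (\<bar>r\<bar> powr p)))" "lp_norm p x" 0] N by simp
  qed
  have "radial_pairing (\<lambda>x. indicator K x * ennreal (lp_norm p x)) (\<lambda>x. ennreal (exp (- (\<Sum>i\<in>UNIV. \<bar>x $ i\<bar> powr p))))
    = (\<integral>\<^sup>+x. ?C * indicator K x \<partial>lborel)"
    unfolding radial_pairing_def
    by (rule nn_integral_cong_AE, rule AE_mp[OF AE_lborel_nonzero], rule AE_I2)
      (simp only: mult.assoc C mult.commute[of ?C] simp_thms imp_refl not_False_eq_True cong: imp_cong)
  also have "\<dots> = ?C * emeasure lborel K" by (rule nn_integral_cmult_indicator) simp
  finally show ?thesis .
qed

text \<open>For a round Gaussian the inner integral is a constant over |x|, and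
  \<open>lp_norm p x\<close> is at most a constant times |x|. The integrand is therefore bounded on
  \<open>K\<close>.\<close>

lemma radial_pairing_lp_gauss_finite:
  fixes K :: "(real ^ 'n) set"
  assumes p: "0 < p" and \<epsilon>: "0 < \<epsilon>" and [measurable]: "K \<in> sets borel" and K: "emeasure lborel K < \<infinity>"
  shows "radial_pairing (\<lambda>x. indicator K x * ennreal (lp_norm p x)) (gauss (\<lambda>_. \<epsilon>)) < \<infinity>"
proof -
  let ?M = "real CARD('n) powr (1 / p) * sqrt (pi / \<epsilon>)"
  have bound: "ennreal (lp_norm p x) * (\<integral>\<^sup>+r. gauss (\<lambda>_. \<epsilon>) (r *\<^sub>R x) \<partial>lborel) \<le> ennreal ?M"
    if "x \<noteq> 0" for x :: "real ^ 'n"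
  proof -
    have nx: "norm x > 0" using that by simp
    have n2: "(norm x)\<^sup>2 = (\<Sum>i\<in>UNIV. (x $ i)\<^sup>2)"
      unfolding power2_norm_eq_inner inner_vec_def by (simp add: power2_eq_square)
    have "gauss (\<lambda>_. \<epsilon>) (r *\<^sub>R x) = ennreal (exp (- (\<epsilon> * (norm x)\<^sup>2) * r\<^sup>2))" for r
      unfolding n2 by (simp add: gauss_def power_mult_distrib sum_distrib_left mult_ac)
    then have "(\<integral>\<^sup>+r. gauss (\<lambda>_. \<epsilon>) (r *\<^sub>R x) \<partial>lborel) = ennreal (sqrt (pi / (\<epsilon> * (norm x)\<^sup>2)))"
      using nn_integral_gauss[of "\<epsilon> * (norm x)\<^sup>2"] \<epsilon> nx by simp
    also have "\<dots> = ennreal (sqrt (pi / \<epsilon>) / norm x)"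
      by (simp add: real_sqrt_divide real_sqrt_mult)
    finally have "ennreal (lp_norm p x) * (\<integral>\<^sup>+r. gauss (\<lambda>_. \<epsilon>) (r *\<^sub>R x) \<partial>lborel)
      = ennreal (lp_norm p x * (sqrt (pi / \<epsilon>) / norm x))"
      using \<epsilon> lp_norm_pos[OF that, of p] by (simp add: ennreal_mult[symmetric] less_imp_le)
    also have "\<dots> \<le> ennreal ?M"
    proof (rule ennreal_leI)
      have "lp_norm p x * (sqrt (pi / \<epsilon>) / norm x) \<le> (real CARD('n) powr (1 / p) * norm x) * (sqrt (pi / \<epsilon>) / norm x)"
        using \<epsilon> by (intro mult_right_mono lp_norm_le p) simp
      then show "lp_norm p x * (sqrt (pi / \<epsilon>) / norm x) \<le> ?M" using nx by simp
    qed
    finally show ?thesis .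
  qed
  have "radial_pairing (\<lambda>x. indicator K x * ennreal (lp_norm p x)) (gauss (\<lambda>_. \<epsilon>))
      \<le> (\<integral>\<^sup>+x. ennreal ?M * indicator K x \<partial>lborel)"
    unfolding radial_pairing_def
    by (rule nn_integral_mono_AE, rule AE_mp[OF AE_lborel_nonzero], rule AE_I2)
      (use bound in \<open>auto simp: indicator_def\<close>)
  also have "\<dots> = ennreal ?M * emeasure lborel K" by (rule nn_integral_cmult_indicator) simp
  also have "\<dots> < \<infinity>" using K by (simp add: ennreal_mult_less_top)
  finally show ?thesis .
qed

text \<open>The choice of exp (- d^2) for the factor tending to 1 gives 1 - exp (- d^2 - d v) = d v
  + O(d^2), so the quotient by d tends to v, including v = 0.\<close>

lemma stable_exponent_tendsto:
  fixes \<alpha> v :: real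
  assumes \<alpha>: "0 < \<alpha>"
  defines "d \<equiv> \<lambda>m. 1 / real (Suc m)"
  shows "(\<lambda>m. ((1 - exp (- (d m)\<^sup>2) * exp (- d m * v)) / d m) powr \<alpha>) \<longlonglongrightarrow> v powr \<alpha>"
proof -
  have "(\<lambda>m. (1 - exp (- (d m)\<^sup>2) * exp (- d m * v)) / d m) \<longlonglongrightarrow> v"
    unfolding d_def by real_asymp
  then show ?thesis
    using \<alpha> by (intro tendsto_powr') (auto simp: d_def)
qed

lemma sets_subspace_lborel [measurable_cong, simp]: "sets (subspace_lborel S) = sets borel"
  by (simp add: subspace_lborel_def Let_def)

text \<open>A Bochner integral defaults to 0 without integrability, so finiteness has to be
  established: \<open>lp_norm\<close> is bounded on the compact set, and the hyperplane measure of a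
  ball is finite.\<close>

lemma section_integral_nn:
  fixes K :: "(real ^ 'n) set"
  assumes p: "0 < p" and K: "compact K" and \<xi>: "norm \<xi> = 1"
  shows "ennreal (LINT x:(K \<inter> {x. \<xi> \<bullet> x = 0})|subspace_lborel {x. \<xi> \<bullet> x = 0}. lp_norm p x)
    = (\<integral>\<^sup>+x. indicator K x * ennreal (lp_norm p x) \<partial>subspace_lborel {x. \<xi> \<bullet> x = 0})"
proof -
  let ?H = "{x. \<xi> \<bullet> x = 0}"
  let ?\<sigma> = "subspace_lborel ?H"
  let ?f = "\<lambda>x. indicator (K \<inter> ?H) x *\<^sub>R lp_norm p x"
  have [measurable]: "K \<in> sets borel" using K by (simp add: borel_compact)
  have [measurable]: "?H \<in> sets borel" by (simp add: closed_hyperplane borel_closed)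
  have [simp]: "\<xi> \<bullet> \<xi> = 1" using \<xi> by (simp add: dot_square_norm)
  have eq: "(\<integral>\<^sup>+x. ennreal (?f x) \<partial>?\<sigma>) = (\<integral>\<^sup>+x. indicator K x * ennreal (lp_norm p x) \<partial>?\<sigma>)"
  proof -
    have "(\<integral>\<^sup>+x. ennreal (?f x) \<partial>?\<sigma>) = (\<integral>\<^sup>+x. indicator ?H x * (indicator K x * ennreal (lp_norm p x)) \<partial>?\<sigma>)"
      by (rule nn_integral_cong) (simp add: indicator_def)
    also have "\<dots> = (\<integral>\<^sup>+x. indicator K x * ennreal (lp_norm p x) \<partial>?\<sigma>)"
      \<comment> \<open>The hyperplane measure is concentrated on \<open>?H\<close>: the projected
        points satisfy its equation, so the indicator drops out.\<close>
      by (simp add: nn_integral_hyperplane[OF \<xi>] inner_diff_right)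
    finally show ?thesis .
  qed
  obtain R where R: "R > 0" "\<And>x. x \<in> K \<Longrightarrow> norm x \<le> R"
    using compact_imp_bounded[OF K] by (auto simp: bounded_pos)
  have lp: "0 \<le> lp_norm p x" for x by (simp add: lp_norm_def)
  have "(\<integral>\<^sup>+x. ennreal (?f x) \<partial>?\<sigma>) \<le> (\<integral>\<^sup>+x. ennreal (real CARD('n) powr (1 / p) * R) * indicator (cball 0 R) x \<partial>?\<sigma>)"
    unfolding eq
  proof (rule nn_integral_mono)
    fix x
    show "indicator K x * ennreal (lp_norm p x) \<le> ennreal (real CARD('n) powr (1 / p) * R) * indicator (cball 0 R) x"
    proof (cases "x \<in> K")
      case True
      have "lp_norm p x \<le> real CARD('n) powr (1 / p) * R"
        using lp_norm_le[OF p, of x] by (rule order_trans) (intro mult_left_mono R(2) True, simp)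
      then show ?thesis using True R(2)[OF True] by (simp add: ennreal_leI)
    qed simp
  qed
  also have "\<dots> = ennreal (real CARD('n) powr (1 / p) * R) * (\<integral>\<^sup>+x. indicator (cball 0 R) x \<partial>?\<sigma>)"
    by (intro nn_integral_cmult borel_measurable_indicator) (simp add: borel_closed)
  also have "(\<integral>\<^sup>+x. indicator (cball 0 R) x \<partial>?\<sigma>) \<le> (\<integral>\<^sup>+x. indicator (cball 0 (R + 1)) x \<partial>(lborel :: (real ^ 'n) measure))"
    unfolding nn_integral_hyperplane[OF \<xi> borel_measurable_indicator[OF borel_closed[OF closed_cball]]]
  proof (rule nn_integral_mono)
    fix x :: "real ^ 'n"
    \<comment> \<open>A point of the unit slab is at distance at most 1 from its projection.\<close>
    have "norm x \<le> R + 1" if "norm (x - (\<xi> \<bullet> x) *\<^sub>R \<xi>) \<le> R" "0 \<le> \<xi> \<bullet> x" "\<xi> \<bullet> x \<le> 1"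
      using that norm_triangle_sub[of x "(\<xi> \<bullet> x) *\<^sub>R \<xi>"] \<xi> by simp
    then show "indicator {0..1} (\<xi> \<bullet> x) * indicator (cball 0 R) (x - (\<xi> \<bullet> x) *\<^sub>R \<xi>) \<le> (indicator (cball 0 (R + 1)) x :: ennreal)"
      by (auto simp: indicator_def)
  qed
  also have "ennreal (real CARD('n) powr (1 / p) * R) * (\<integral>\<^sup>+x. indicator (cball 0 (R + 1)) x \<partial>(lborel :: (real ^ 'n) measure)) < \<infinity>"
    using emeasure_bounded_finite[OF bounded_cball[of "0 :: real ^ 'n" "R + 1"]] by (simp add: ennreal_mult_less_top)
  finally have "(\<integral>\<^sup>+x. ennreal (?f x) \<partial>?\<sigma>) < \<infinity>" by (simp add: mult_left_mono)
  then have "integrable ?\<sigma> ?f"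
    by (intro integrableI_nonneg) (auto simp: lp)
  then have "(\<integral>\<^sup>+x. ennreal (?f x) \<partial>?\<sigma>) = ennreal (integral\<^sup>L ?\<sigma> ?f)"
    by (intro nn_integral_eq_integral) (auto simp: lp)
  then show ?thesis unfolding eq set_lebesgue_integral_def by (rule sym)
qed

text \<open>Two limits are taken. The mixtures approximating \<open>g p\<close> do not decay at
  infinity, so they are first multiplied by a Gaussian, which serves as integrable majorant. That
  Gaussian is then flattened to 1, with \<open>g p\<close> itself as majorant.\<close>

lemma radial_pairing_lp_le:
  fixes F1 F2 :: "real ^ 'n \<Rightarrow> ennreal"
  defines "g \<equiv> \<lambda>p (x :: real ^ 'n). ennreal (exp (- (\<Sum>i\<in>UNIV. \<bar>x $ i\<bar> powr p)))"
  assumes p: "0 < p" "p \<le> 2"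
    and [measurable]: "F1 \<in> borel_measurable borel" "F2 \<in> borel_measurable borel"
    and F: "\<And>x. F1 x < \<infinity>" "\<And>x. F2 x < \<infinity>"
    and le: "\<And>s. (\<And>i. s i > 0) \<Longrightarrow> radial_pairing F1 (gauss s) \<le> radial_pairing F2 (gauss s)"
    and fin: "\<And>\<epsilon>. \<epsilon> > 0 \<Longrightarrow> radial_pairing F1 (gauss (\<lambda>_. \<epsilon>)) < \<infinity>" "\<And>\<epsilon>. \<epsilon> > 0 \<Longrightarrow> radial_pairing F2 (gauss (\<lambda>_. \<epsilon>)) < \<infinity>"
    and fin': "radial_pairing F1 (g p) < \<infinity>" "radial_pairing F2 (g p) < \<infinity>"
  shows "radial_pairing F1 (g p) \<le> radial_pairing F2 (g p)"
proof -
  have [measurable]: "g p \<in> borel_measurable borel" unfolding g_def by measurable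
  define d where "d m = 1 / real (Suc m)" for m
  \<comment> \<open>The approximation of \<open>gauss_mixture_stable_approx\<close> with \<alpha> =
    p / 2, \<delta> = \<open>d m\<close> and \<eta> = exp (- (d m)^2).\<close>
  define h where "h m x = ennreal (exp (- (\<Sum>i\<in>UNIV. ((1 - exp (- (d m)\<^sup>2) * exp (- d m * (x $ i)\<^sup>2)) / d m) powr (p / 2))))"
    for m and x :: "real ^ 'n"
  have d: "d m > 0" for m by (simp add: d_def)
  have hmix: "gauss_mixture (h m)" for m
    unfolding h_def using p d[of m] by (intro gauss_mixture_stable_approx) auto
  note [measurable] = gauss_mixture_measurable[OF hmix]
  have h1: "h m x \<le> 1" for m x
    unfolding h_def by (subst ennreal_1[symmetric], rule ennreal_leI) (simp add: sum_nonneg)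
  have hlim: "(\<lambda>m. h m x) \<longlonglongrightarrow> g p x" for x
  proof -
    have "((x $ i)\<^sup>2) powr (p / 2) = \<bar>x $ i\<bar> powr p" for i
    proof -
      have "((x $ i)\<^sup>2) powr (p / 2) = (\<bar>x $ i\<bar> powr 2) powr (p / 2)" by simp
      also have "\<dots> = \<bar>x $ i\<bar> powr p" by (simp only: powr_powr) simp
      finally show ?thesis .
    qed
    then have "(\<lambda>m. ((1 - exp (- (d m)\<^sup>2) * exp (- d m * (x $ i)\<^sup>2)) / d m) powr (p / 2)) \<longlonglongrightarrow> \<bar>x $ i\<bar> powr p" for i
      using stable_exponent_tendsto[of "p / 2" "(x $ i)\<^sup>2"] p unfolding d_def by simp
    then show ?thesis
      unfolding h_def g_def by (intro tendsto_ennrealI tendsto_exp tendsto_minus tendsto_sum)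
  qed
  have stage1: "radial_pairing F1 (\<lambda>x. g p x * gauss (\<lambda>_. \<epsilon>) x) \<le> radial_pairing F2 (\<lambda>x. g p x * gauss (\<lambda>_. \<epsilon>) x)"
    if \<epsilon>: "\<epsilon> > 0" for \<epsilon>
  proof (rule LIMSEQ_le)
    have hle: "h m x * gauss (\<lambda>_. \<epsilon>) x \<le> gauss (\<lambda>_. \<epsilon>) x" for m x
      using mult_right_mono[OF h1[of m x], of "gauss (\<lambda>_. \<epsilon>) x"] by simp
    have lim: "(\<lambda>m. h m x * gauss (\<lambda>_. \<epsilon>) x) \<longlonglongrightarrow> g p x * gauss (\<lambda>_. \<epsilon>) x" for x
      using ennreal_tendsto_cmult[OF _ hlim[of x], of "gauss (\<lambda>_. \<epsilon>) x"] by (simp add: mult.commute gauss_def)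
    show "(\<lambda>m. radial_pairing F1 (\<lambda>x. h m x * gauss (\<lambda>_. \<epsilon>) x)) \<longlonglongrightarrow> radial_pairing F1 (\<lambda>x. g p x * gauss (\<lambda>_. \<epsilon>) x)"
      by (rule radial_pairing_dominated_convergence[where h="gauss (\<lambda>_. \<epsilon>)"]) (use hle lim F fin \<epsilon> in auto)
    show "(\<lambda>m. radial_pairing F2 (\<lambda>x. h m x * gauss (\<lambda>_. \<epsilon>) x)) \<longlonglongrightarrow> radial_pairing F2 (\<lambda>x. g p x * gauss (\<lambda>_. \<epsilon>) x)"
      by (rule radial_pairing_dominated_convergence[where h="gauss (\<lambda>_. \<epsilon>)"]) (use hle lim F fin \<epsilon> in auto)
    show "\<exists>N. \<forall>m\<ge>N. radial_pairing F1 (\<lambda>x. h m x * gauss (\<lambda>_. \<epsilon>) x) \<le> radial_pairing F2 (\<lambda>x. h m x * gauss (\<lambda>_. \<epsilon>) x)"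
      using radial_pairing_mixture_le[OF _ _ le hmix, of "\<lambda>_. \<epsilon>"] \<epsilon> by auto
  qed
  show ?thesis
  proof (rule LIMSEQ_le)
    have le1: "g p x * gauss (\<lambda>_. d m) x \<le> g p x" for m x
    proof -
      have "gauss (\<lambda>_. d m) x \<le> 1"
        unfolding gauss_def by (subst ennreal_1[symmetric], rule ennreal_leI) (simp add: sum_nonneg d less_imp_le)
      from mult_left_mono[OF this, of "g p x"] show ?thesis by simp
    qed
    have lim: "(\<lambda>m. g p x * gauss (\<lambda>_. d m) x) \<longlonglongrightarrow> g p x" for x
    proof -
      have "d \<longlonglongrightarrow> 0" unfolding d_def by real_asymp
      then have "(\<lambda>m. gauss (\<lambda>_. d m) x) \<longlonglongrightarrow> ennreal (exp (- (\<Sum>i\<in>UNIV. 0 * (x $ i)\<^sup>2)))"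
        unfolding gauss_def by (intro tendsto_ennrealI tendsto_intros)
      from ennreal_tendsto_cmult[OF _ this, of "g p x"] show ?thesis by (simp add: g_def)
    qed
    show "(\<lambda>m. radial_pairing F1 (\<lambda>x. g p x * gauss (\<lambda>_. d m) x)) \<longlonglongrightarrow> radial_pairing F1 (g p)"
      by (rule radial_pairing_dominated_convergence[where h="g p"]) (use le1 lim F fin' in auto)
    show "(\<lambda>m. radial_pairing F2 (\<lambda>x. g p x * gauss (\<lambda>_. d m) x)) \<longlonglongrightarrow> radial_pairing F2 (g p)"
      by (rule radial_pairing_dominated_convergence[where h="g p"]) (use le1 lim F fin' in auto)
    show "\<exists>N. \<forall>m\<ge>N. radial_pairing F1 (\<lambda>x. g p x * gauss (\<lambda>_. d m) x) \<le> radial_pairing F2 (\<lambda>x. g p x * gauss (\<lambda>_. d m) x)"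
      using stage1[OF d] by auto
  qed
qed

theorem corollary4:
  fixes p :: real and K L :: "(real ^ 'n) set"
  assumes "0 < p" and "p \<le> 2"
    and "CARD('n) \<ge> 2"
    and "star_body K" and "origin_symmetric K"
    and "star_body L" and "origin_symmetric L"
    and "\<forall>\<xi>\<in>sphere 0 1.
           (LINT x:(K \<inter> {x. \<xi> \<bullet> x = 0})|subspace_lborel {x. \<xi> \<bullet> x = 0}. lp_norm p x)
         \<le> (LINT x:(L \<inter> {x. \<xi> \<bullet> x = 0})|subspace_lborel {x. \<xi> \<bullet> x = 0}. lp_norm p x)"
  shows "measure lborel K \<le> measure lborel L"
proof -
  note p = assms(1,2)
  have K: "compact K" and L: "compact L" using assms(4,6) by (simp_all add: star_body_def)
  have [measurable]: "K \<in> sets borel" "L \<in> sets borel"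
    using K L by (simp_all add: borel_compact)
  have finK: "emeasure lborel K < \<infinity>" and finL: "emeasure lborel L < \<infinity>"
    using emeasure_bounded_finite[OF compact_imp_bounded[OF K]] emeasure_bounded_finite[OF compact_imp_bounded[OF L]]
    by simp_all
  let ?F = "\<lambda>A x. indicator A x * ennreal (lp_norm p x)"
  let ?C = "\<integral>\<^sup>+r. ennreal (exp (- (\<bar>r\<bar> powr p))) \<partial>lborel"
  let ?g = "\<lambda>x :: real ^ 'n. ennreal (exp (- (\<Sum>i\<in>UNIV. \<bar>x $ i\<bar> powr p)))"
  have C: "?C < \<infinity>" by (rule nn_integral_exp_powr_finite[OF p(1)])
  have C0: "?C \<noteq> 0" by (subst nn_integral_0_iff_AE) (simp_all add: AE_iff_null null_sets_def)
  have sections: "(\<integral>\<^sup>+x. ?F K x \<partial>subspace_lborel {x. \<xi> \<bullet> x = 0}) \<le> (\<integral>\<^sup>+x. ?F L x \<partial>subspace_lborel {x. \<xi> \<bullet> x = 0})"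
    if \<xi>: "norm \<xi> = 1" for \<xi>
    unfolding section_integral_nn[OF p(1) K \<xi>, symmetric] section_integral_nn[OF p(1) L \<xi>, symmetric]
    using assms(8) \<xi> by (intro ennreal_leI) simp
  \<comment> \<open>Each of these pairings is \<open>?C\<close> times a volume, and
    \<open>?C\<close> is positive and finite, so it can be cancelled afterwards.\<close>
  have "radial_pairing (?F K) ?g \<le> radial_pairing (?F L) ?g"
  proof (rule radial_pairing_lp_le[OF p])
    show "radial_pairing (?F K) (gauss s) \<le> radial_pairing (?F L) (gauss s)" if "\<And>i. s i > 0" for s
      by (rule radial_pairing_gauss_le[OF _ _ assms(3) that sections]) measurable
    show "radial_pairing (?F K) ?g < \<infinity>" "radial_pairing (?F L) ?g < \<infinity>"
      using C finK finL by (simp_all add: radial_pairing_lp[OF p(1)] ennreal_mult_less_top)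
    show "radial_pairing (?F K) (gauss (\<lambda>_. \<epsilon>)) < \<infinity>" "radial_pairing (?F L) (gauss (\<lambda>_. \<epsilon>)) < \<infinity>" if "\<epsilon> > 0" for \<epsilon>
      using finK finL by (intro radial_pairing_lp_gauss_finite[OF p(1) that]; simp)+
  qed (auto simp: indicator_def)
  then have "?C * emeasure lborel K \<le> ?C * emeasure lborel L"
    by (simp add: radial_pairing_lp[OF p(1)])
  then have "emeasure lborel K \<le> emeasure lborel L"
    using C C0 by (subst (asm) ennreal_mult_le_mult_iff) auto
  then show ?thesis
    using finL unfolding measure_def by (intro enn2real_mono) auto
qed

end
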